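(* Let $\mathbb{H}$ be a real Hilbert space and $p$ a positive integer, with $\dim\mathbb{H}\ge 2p$ if $\mathbb{H}$ is finite dimensional. Then the Stiefel manifold $(\mathbf{St}(p,\mathbb{H}),\langle\cdot,\cdot\rangle)$ is Hopf-Rinow, i.e. any two of its points can be connected by a minimizing geodesic.
   Context: $\mathbf{St}(p,\mathbb{H})=\{x\in L(\mathbb{R}^p,\mathbb{H}) : x^t\circ x=\mathrm{Id}_{\mathbb{R}^p}\}$, a closed submanifold of the Hilbert space $L(\mathbb{R}^p,\mathbb{H})$ of linear maps with inner product $\langle x,y\rangle=\mathrm{Tr}(x^t\circ y)$, where $x^t$ is the transpose. The metric $\langle\cdot,\cdot\rangle$ on $\mathbf{St}(p,\mathbb{H})$ is the Riemannian metric induced by this embedding. A minimizing geodesic is a geodesic whose length equals the Riemannian distance between its endpoints. $\mathbb{H}$ is not assumed separable. *)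

theory Defs
  imports "HOL-Analysis.Analysis"
begin

text \<open>
  \<open>L(\<real>\<^sup>p, \<bbbH>)\<close> is the library type \<open>(real ^ 'p) \<Rightarrow>\<^sub>L 'h\<close> of bounded linear maps
  (with domain \<open>\<real>\<^sup>p\<close> every linear map is bounded), where \<open>p = CARD('p)\<close>.
  The type carries the operator norm, not the norm of the inner product below; the two norms
  are equivalent because \<open>p\<close> is finite, so continuity and derivatives of curves in
  \<open>L(\<real>\<^sup>p, \<bbbH>)\<close> do not depend on the choice. Lengths and orthogonality always use the
  inner product below.

  The library constant \<^const>\<open>adjoint\<close> is defined for maps between arbitrary real inner product
  spaces; for a linear map with finite-dimensional domain the adjoint exists and is unique, so
  it is the transpose also when \<open>'h\<close> is infinite-dimensional.
\<close>

definition stiefel :: "((real ^ 'p::finite) \<Rightarrow>\<^sub>L 'h::{real_inner, complete_space}) set"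
  where "stiefel = {x. adjoint (blinfun_apply x) \<circ> blinfun_apply x = id}"

definition tr_inner ::
    "((real ^ 'p::finite) \<Rightarrow>\<^sub>L 'h::{real_inner, complete_space}) \<Rightarrow> ((real ^ 'p) \<Rightarrow>\<^sub>L 'h) \<Rightarrow> real"
  where "tr_inner x y = trace (matrix (adjoint (blinfun_apply x) \<circ> blinfun_apply y))"

definition tr_norm :: "((real ^ 'p::finite) \<Rightarrow>\<^sub>L 'h::{real_inner, complete_space}) \<Rightarrow> real"
  where "tr_norm x = sqrt (tr_inner x x)"

text \<open>
  In the rest of the theory \<open>M\<close> is meant to be a closed submanifold of \<open>L(\<real>\<^sup>p, \<bbbH>)\<close> with the
  Riemannian metric induced by \<^const>\<open>tr_inner\<close>. Curves are parametrized by \<open>{0..1}\<close>, with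
  one-sided derivatives at the end points.
\<close>

definition velocity :: "(real \<Rightarrow> 'a::real_normed_vector) \<Rightarrow> real \<Rightarrow> 'a"
  where "velocity \<gamma> t = vector_derivative \<gamma> (at t within {0..1})"

definition smooth_curve :: "(real \<Rightarrow> 'a::real_normed_vector) \<Rightarrow> bool"
  where "smooth_curve \<gamma> \<longleftrightarrow> (\<forall>n. (velocity ^^ n) \<gamma> differentiable_on {0..1})"

definition tangent_space :: "'a::real_normed_vector set \<Rightarrow> 'a \<Rightarrow> 'a set"
  where "tangent_space M x =
    {v. \<exists>c e. e > 0 \<and> c C1_differentiable_on {-e<..<e} \<and> c ` {-e<..<e} \<subseteq> M \<and>
          c 0 = x \<and> (c has_vector_derivative v) (at 0)}"

text \<open>Orthogonal projection onto the tangent space at \<open>x\<close>.\<close>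

definition tangential_part ::
    "((real ^ 'p::finite) \<Rightarrow>\<^sub>L 'h::{real_inner, complete_space}) set \<Rightarrow>
      ((real ^ 'p) \<Rightarrow>\<^sub>L 'h) \<Rightarrow> ((real ^ 'p) \<Rightarrow>\<^sub>L 'h) \<Rightarrow> ((real ^ 'p) \<Rightarrow>\<^sub>L 'h)"
  where "tangential_part M x a =
    (THE v. v \<in> tangent_space M x \<and> (\<forall>w\<in>tangent_space M x. tr_inner (a - v) w = 0))"

text \<open>
  The Levi-Civita connection of the induced metric differentiates a tangent field along a
  curve in the ambient Hilbert space and projects the result orthogonally onto the tangent space.
\<close>

definition covariant_derivative ::
    "((real ^ 'p::finite) \<Rightarrow>\<^sub>L 'h::{real_inner, complete_space}) set \<Rightarrow>
      (real \<Rightarrow> ((real ^ 'p) \<Rightarrow>\<^sub>L 'h)) \<Rightarrow> (real \<Rightarrow> ((real ^ 'p) \<Rightarrow>\<^sub>L 'h)) \<Rightarrow> real \<Rightarrow> ((real ^ 'p) \<Rightarrow>\<^sub>L 'h)"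
  where "covariant_derivative M \<gamma> X t = tangential_part M (\<gamma> t) (velocity X t)"

definition geodesic ::
    "((real ^ 'p::finite) \<Rightarrow>\<^sub>L 'h::{real_inner, complete_space}) set \<Rightarrow>
      (real \<Rightarrow> ((real ^ 'p) \<Rightarrow>\<^sub>L 'h)) \<Rightarrow> bool"
  where "geodesic M \<gamma> \<longleftrightarrow> smooth_curve \<gamma> \<and> path_image \<gamma> \<subseteq> M \<and>
    (\<forall>t\<in>{0..1}. covariant_derivative M \<gamma> (velocity \<gamma>) t = 0)"

text \<open>
  Lengths take values in the extended nonnegative reals: \<^const>\<open>valid_path\<close> does not bound the
  velocity near the finitely many break points, so a valid path may have infinite length. Such
  paths, and those of finite length but unbounded velocity, do not affect the infimum
  \<open>riemannian_dist\<close>. The infimum of the empty set is \<open>\<infinity>\<close>.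
\<close>

definition curve_length ::
    "(real \<Rightarrow> ((real ^ 'p::finite) \<Rightarrow>\<^sub>L 'h::{real_inner, complete_space})) \<Rightarrow> ennreal"
  where "curve_length \<gamma> = (\<integral>\<^sup>+t\<in>{0..1}. ennreal (tr_norm (velocity \<gamma> t)) \<partial>lborel)"

definition riemannian_dist ::
    "((real ^ 'p::finite) \<Rightarrow>\<^sub>L 'h::{real_inner, complete_space}) set \<Rightarrow>
      ((real ^ 'p) \<Rightarrow>\<^sub>L 'h) \<Rightarrow> ((real ^ 'p) \<Rightarrow>\<^sub>L 'h) \<Rightarrow> ennreal"
  where "riemannian_dist M x y =
    Inf (curve_length ` {\<gamma>. valid_path \<gamma> \<and> path_image \<gamma> \<subseteq> M \<and> pathstart \<gamma> = x \<and> pathfinish \<gamma> = y})"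

definition minimizing_geodesic ::
    "((real ^ 'p::finite) \<Rightarrow>\<^sub>L 'h::{real_inner, complete_space}) set \<Rightarrow>
      (real \<Rightarrow> ((real ^ 'p) \<Rightarrow>\<^sub>L 'h)) \<Rightarrow> bool"
  where "minimizing_geodesic M \<gamma> \<longleftrightarrow> geodesic M \<gamma> \<and>
    curve_length \<gamma> = riemannian_dist M (pathstart \<gamma>) (pathfinish \<gamma>)"

definition hopf_rinow ::
    "((real ^ 'p::finite) \<Rightarrow>\<^sub>L 'h::{real_inner, complete_space}) set \<Rightarrow> bool"
  where "hopf_rinow M \<longleftrightarrow> (\<forall>x\<in>M. \<forall>y\<in>M. \<exists>\<gamma>.
    minimizing_geodesic M \<gamma> \<and> pathstart \<gamma> = x \<and> pathfinish \<gamma> = y)"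

end

theory Submission
  imports Defs
begin

text \<open>
  Direct minimization over discrete paths. Among the chains \<open>x = z\<^sub>0, \<dots>, z\<^sub>N = y\<close> in the Stiefel
  manifold take one that minimizes \<open>\<Sum> \<parallel>z\<^sub>i\<^sub>+\<^sub>1 - z\<^sub>i\<parallel>\<^sup>2\<close>. A minimizer exists because a chain involves
  finitely many vectors of \<open>\<bbbH>\<close>, which an isometry fixing the ranges of \<open>x\<close> and \<open>y\<close> moves into a
  finite-dimensional subspace depending on \<open>N\<close> alone. Its Euler--Lagrange equation is the recursion
  \<open>z\<^sub>i\<^sub>+\<^sub>1 - 2 z\<^sub>i + z\<^sub>i\<^sub>-\<^sub>1 = - z\<^sub>i (\<Delta>\<^sub>i\<^sup>t \<Delta>\<^sub>i + \<Delta>\<^sub>i\<^sub>-\<^sub>1\<^sup>t \<Delta>\<^sub>i\<^sub>-\<^sub>1) / 2\<close> with \<open>\<Delta>\<^sub>i = z\<^sub>i\<^sub>+\<^sub>1 - z\<^sub>i\<close>, so the whole chain lies in the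
  span of the ranges of \<open>z\<^sub>0\<close> and \<open>z\<^sub>1\<close>. Hence all minimizers can be moved into one
  finite-dimensional subspace, independent of \<open>N\<close>, where they have a limit as \<open>N \<rightarrow> \<infinity>\<close>. The recursion
  turns into the geodesic equation \<open>\<gamma>'' = - \<gamma> (\<gamma>'\<^sup>t \<gamma>')\<close>. A competing path of length \<open>L\<close>, cut into \<open>N\<close> pieces of
  equal length, is a chain of energy at most \<open>L\<^sup>2 / N\<close>, which gives \<open>\<parallel>\<gamma>'\<parallel> \<le> L\<close>. The
  dimension hypothesis only serves to connect \<open>x\<close> and \<open>y\<close> by some path, by successive plane rotations.
\<close>


section \<open>Isometries into finite-dimensional subspaces\<close>

definition orthonormal :: "'a::real_inner set \<Rightarrow> bool"
  where "orthonormal S \<longleftrightarrow> pairwise orthogonal S \<and> (\<forall>e\<in>S. norm e = 1)"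

lemma orthonormal_inner:
  assumes "orthonormal S" "d \<in> S" "e \<in> S"
  shows "d \<bullet> e = (if d = e then 1 else 0)"
  using assms by (auto simp: orthonormal_def pairwise_def orthogonal_def norm_eq_1)

lemma orthonormal_sum_inner:
  assumes "orthonormal S" "finite S" "e \<in> S"
  shows "(\<Sum>d\<in>S. c d *\<^sub>R d) \<bullet> e = c e"
proof -
  have "(\<Sum>d\<in>S. c d *\<^sub>R d) \<bullet> e = (\<Sum>d\<in>S. if d = e then c d else 0)"
    unfolding inner_sum_left using orthonormal_inner[OF assms(1) _ assms(3)]
    by (intro sum.cong) auto
  then show ?thesis
    using assms by simp
qed

lemma orthonormal_expansion:
  assumes "orthonormal S" "finite S" "u \<in> span S"
  shows "(\<Sum>e\<in>S. (u \<bullet> e) *\<^sub>R e) = u"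
proof -
  obtain c where c: "u = (\<Sum>d\<in>S. c d *\<^sub>R d)"
    using assms(3) span_finite[OF assms(2)] by auto
  then have "u \<bullet> e = c e" if "e \<in> S" for e
    using orthonormal_sum_inner[OF assms(1,2) that] by simp
  then show ?thesis
    by (simp add: c)
qed

lemma orthonormal_parseval:
  assumes "orthonormal S" "finite S" "u \<in> span S"
  shows "u \<bullet> v = (\<Sum>e\<in>S. (u \<bullet> e) * (v \<bullet> e))"
proof -
  have "u \<bullet> v = (\<Sum>e\<in>S. (u \<bullet> e) *\<^sub>R e) \<bullet> v"
    by (simp add: orthonormal_expansion[OF assms])
  also have "\<dots> = (\<Sum>e\<in>S. (u \<bullet> e) * (v \<bullet> e))"
    unfolding inner_sum_left inner_scaleR_left by (simp only: inner_commute)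
  finally show ?thesis .
qed

text \<open>One Gram-Schmidt step: subtract from \<open>z\<close> its projection, written out in the
  orthonormal vectors of \<open>S\<close>, and normalize.\<close>

lemma unit_normal_exists:
  fixes S :: "'a::real_inner set"
  assumes S: "orthonormal S" "finite S" and z: "z \<notin> span S"
  obtains e where "norm e = 1" "\<And>u. u \<in> span S \<Longrightarrow> e \<bullet> u = 0" "span (insert e S) = span (insert z S)"
proof
  define r where "r = z - (\<Sum>e\<in>S. (z \<bullet> e) *\<^sub>R e)"
  have s: "(\<Sum>e\<in>S. (z \<bullet> e) *\<^sub>R e) \<in> span S"
    by (intro span_sum span_scale span_base)
  then have "r \<noteq> 0"
    using z by (auto simp: r_def)
  have "r \<bullet> e = 0" if "e \<in> S" for e
    using orthonormal_sum_inner[OF S that] by (simp add: r_def inner_diff_left)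
  then have orth: "orthogonal r u" if "u \<in> span S" for u
    using that orthogonal_to_span orthogonal_def by metis
  show "norm (sgn r) = 1"
    using \<open>r \<noteq> 0\<close> by (simp add: norm_sgn)
  show "sgn r \<bullet> u = 0" if "u \<in> span S" for u
    using orth[OF that] by (simp add: sgn_div_norm orthogonal_def)
  have "span (insert z S) = span (insert r S)"
  proof -
    have "z - r \<in> span S"
      using s by (simp add: r_def)
    then show ?thesis
      by (rule eq_span_insert_eq)
  qed
  also have "\<dots> = span (insert (sgn r) S)"
  proof (rule subset_antisym; rule span_minimal)
    have "r = norm r *\<^sub>R sgn r"
      using \<open>r \<noteq> 0\<close> by (simp add: sgn_div_norm)
    then have "r \<in> span (insert (sgn r) S)"
      by (metis insertI1 span_base span_scale)
    then show "insert r S \<subseteq> span (insert (sgn r) S)"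
      by (auto intro: span_base)
    have "sgn r \<in> span (insert r S)"
      by (simp add: sgn_div_norm span_base span_scale)
    then show "insert (sgn r) S \<subseteq> span (insert r S)"
      by (auto intro: span_base)
  qed auto
  finally show "span (insert (sgn r) S) = span (insert z S)"
    by simp
qed

lemma orthonormal_insert:
  fixes S :: "'a::real_inner set"
  assumes "orthonormal S" "norm e = 1" "\<And>u. u \<in> span S \<Longrightarrow> e \<bullet> u = 0"
  shows "orthonormal (insert e S)" "e \<notin> S"
proof -
  show "orthonormal (insert e S)"
    using assms span_base[of _ S]
    by (auto simp: orthonormal_def pairwise_insert orthogonal_def inner_commute)
  show "e \<notin> S"
    using assms span_base[of e S] by (auto simp: norm_eq_1)
qed

text \<open>Gram-Schmidt over \<open>Z\<close>; a vector already in the span contributes nothing,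
  hence an inequality for the cardinality.\<close>

lemma orthonormal_extend:
  fixes S :: "'a::real_inner set"
  assumes S: "orthonormal S" "finite S" and Z: "finite Z"
  shows "\<exists>S'. S \<subseteq> S' \<and> finite S' \<and> orthonormal S' \<and> span S' = span (S \<union> Z) \<and>
    card S' \<le> card S + card Z"
  using Z
proof (induction Z)
  case empty
  then show ?case
    using S by auto
next
  case (insert z Z)
  then obtain T where T: "S \<subseteq> T" "finite T" "orthonormal T" "span T = span (S \<union> Z)"
    "card T \<le> card S + card Z"
    by auto
  have ins: "span (S \<union> insert z Z) = span (insert z T)"
    using T(4) span_insert by (metis Un_insert_right)
  show ?case
  proof (cases "z \<in> span T")
    case True
    then show ?thesis
      using T insert.hyps unfolding ins span_redundant[OF True] by (intro exI[of _ T]) auto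
  next
    case False
    then obtain e where e: "norm e = 1" "\<And>u. u \<in> span T \<Longrightarrow> e \<bullet> u = 0"
      "span (insert e T) = span (insert z T)"
      using unit_normal_exists[OF T(3,2)] by blast
    then show ?thesis
      using orthonormal_insert[OF T(3) e(1,2)] T insert.hyps ins
      by (intro exI[of _ "insert e T"]) auto
  qed
qed

lemma orthonormal_enlarge:
  fixes S :: "'a::real_inner set"
  assumes S: "orthonormal S" "finite S"
    and inf: "\<nexists>B :: 'a set. finite B \<and> span B = UNIV"
  shows "\<exists>S'. S \<subseteq> S' \<and> finite S' \<and> orthonormal S' \<and> card S' = card S + m"
proof (induction m)
  case 0
  then show ?case
    using S by auto
next
  case (Suc m)
  then obtain T where T: "S \<subseteq> T" "finite T" "orthonormal T" "card T = card S + m"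
    by auto
  then obtain z where "z \<notin> span T"
    using inf by blast
  then obtain e where e: "norm e = 1" "\<And>u. u \<in> span T \<Longrightarrow> e \<bullet> u = 0"
    using unit_normal_exists[OF T(3,2)] by blast
  then show ?case
    using orthonormal_insert[OF T(3) e] T by (intro exI[of _ "insert e T"]) auto
qed

text \<open>\<open>T\<close> sends the vectors of \<open>S\<close> to distinct vectors of
  \<open>F\<close>, keeps those of \<open>R\<close> in place, and kills the orthogonal complement of
  \<open>S\<close>. Since \<open>R\<close> lies in both sets, cancelling it from the cardinalities
  leaves enough room in \<open>F - R\<close> for \<open>S - R\<close>.\<close>

lemma orthonormal_embedding:
  fixes S F R :: "'a::real_inner set"
  assumes S: "orthonormal S" "finite S" and F: "orthonormal F" "finite F"
    and R: "R \<subseteq> S" "R \<subseteq> F" and card: "card S \<le> card F"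
  shows "\<exists>T. linear T \<and> (\<forall>u\<in>span S. \<forall>v\<in>span S. T u \<bullet> T v = u \<bullet> v) \<and>
    (\<forall>u\<in>span R. T u = u) \<and> (\<forall>u. T u \<in> span F)"
proof -
  have fR: "finite R"
    using R S finite_subset by auto
  have "card (S - R) \<le> card (F - R)"
    using card R fR S F by (simp add: card_Diff_subset)
  then obtain g where g: "g ` (S - R) \<subseteq> F - R" "inj_on g (S - R)"
    using card_le_inj[of "S - R" "F - R"] S F by auto
  define f where "f e = (if e \<in> R then e else g e)" for e
  have f: "f e \<in> F" if "e \<in> S" for e
    using g R that by (auto simp: f_def)
  have injf: "inj_on f S"
    using g by (auto simp: inj_on_def f_def)
  define T where "T u = (\<Sum>e\<in>S. (u \<bullet> e) *\<^sub>R f e)" for u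
  have lin: "linear T"
    by (rule linearI)
       (simp_all add: T_def inner_add_left scaleR_add_left sum.distrib scaleR_sum_right)
  have "T u \<bullet> T v = u \<bullet> v" if "u \<in> span S" "v \<in> span S" for u v
  proof -
    have "f e \<bullet> T v = v \<bullet> e" if "e \<in> S" for e
    proof -
      have "f e \<bullet> T v = (\<Sum>d\<in>S. if d = e then v \<bullet> d else 0)"
        unfolding T_def inner_sum_right
        using orthonormal_inner[OF F(1) f f] injf that by (intro sum.cong) (auto simp: inj_on_def)
      then show ?thesis
        using S(2) that by simp
    qed
    then have "T u \<bullet> T v = (\<Sum>e\<in>S. (u \<bullet> e) * (v \<bullet> e))"
      unfolding T_def[of u] inner_sum_left by simp
    then show ?thesis
      using orthonormal_parseval[OF S that(1), of v] by metis
  qed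
  moreover have "T u = u" if "u \<in> span R" for u
  proof -
    have "T e = e" if "e \<in> R" for e
    proof -
      have "T e = (\<Sum>d\<in>S. if d = e then e else 0)"
        unfolding T_def using orthonormal_inner[OF S(1)] R that
        by (intro sum.cong) (auto simp: f_def)
      then show ?thesis
        using R that S(2) by auto
    qed
    then show ?thesis
      using linear_eq_on[OF lin linear_id that] by simp
  qed
  moreover have "T u \<in> span F" for u
    unfolding T_def by (intro span_sum span_scale span_base f)
  ultimately show ?thesis
    using lin by blast
qed

text \<open>\<open>F\<close> is chosen before \<open>Z\<close>. It consists of an orthonormal basis
  of \<open>span U\<close> and \<open>m\<close> further vectors, as many as \<open>Z\<close> can add
  to that basis.\<close>

lemma isometric_compression:
  fixes U :: "'a::real_inner set"
  assumes "finite U"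
  shows "\<exists>F. finite F \<and> (\<forall>Z. finite Z \<and> card Z \<le> m \<longrightarrow>
    (\<exists>T. linear T \<and> (\<forall>u\<in>span (U \<union> Z). \<forall>v\<in>span (U \<union> Z). T u \<bullet> T v = u \<bullet> v) \<and>
      (\<forall>u\<in>U. T u = u) \<and> (\<forall>u. T u \<in> span F)))"
proof (cases "\<exists>B :: 'a set. finite B \<and> span B = UNIV")
  case True
  then obtain B :: "'a set" where "finite B" "span B = UNIV"
    by blast
  then show ?thesis
    \<comment> \<open>In a finite-dimensional space the identity already maps into the span of a
      finite set.\<close>
    by (intro exI[of _ B] conjI allI impI exI[of _ id]) (auto simp: linear_id)
next
  case False
  have "orthonormal ({} :: 'a set)"
    by (simp add: orthonormal_def)
  then obtain R where R: "finite R" "orthonormal R" "span R = span U"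
    using orthonormal_extend[of "{}" U] assms by auto
  obtain F where F: "R \<subseteq> F" "finite F" "orthonormal F" "card F = card R + m"
    using orthonormal_enlarge[OF R(2,1) False] by blast
  have "\<exists>T. linear T \<and> (\<forall>u\<in>span (U \<union> Z). \<forall>v\<in>span (U \<union> Z). T u \<bullet> T v = u \<bullet> v) \<and>
      (\<forall>u\<in>U. T u = u) \<and> (\<forall>u. T u \<in> span F)" if Z: "finite Z" "card Z \<le> m" for Z
  proof -
    obtain S where S: "R \<subseteq> S" "finite S" "orthonormal S" "span S = span (R \<union> Z)"
      "card S \<le> card R + card Z"
      using orthonormal_extend[OF R(2,1) Z(1)] by blast
    have "span (U \<union> Z) = span S"
      using S(4) R(3) by (simp add: span_Un)
    then show ?thesis
      using orthonormal_embedding[OF S(3,2) F(3,2) S(1) F(1)] S F Z R(3) span_base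
      by (metis (no_types, lifting) le_trans nat_add_left_cancel_le)
  qed
  then show ?thesis
    using F by blast
qed

text \<open>A form of Heine-Borel inside a possibly infinite-dimensional space: the set is a
  Minkowski sum of compact segments.\<close>

lemma compact_bounded_combinations:
  fixes B :: "'a::real_normed_vector set"
  assumes "finite B"
  shows "compact {\<Sum>b\<in>B. c b *\<^sub>R b |c. \<forall>b\<in>B. \<bar>c b\<bar> \<le> r}"
  using assms
proof (induction B)
  case empty
  show ?case by simp
next
  case (insert b B)
  let ?A = "{\<Sum>b\<in>B. c b *\<^sub>R b |c. \<forall>b\<in>B. \<bar>c b\<bar> \<le> r}"
  let ?I = "(\<lambda>t. t *\<^sub>R b) ` {-r..r}"
  have "compact {x + y |x y. x \<in> ?I \<and> y \<in> ?A}"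
    using insert.IH by (intro compact_sums compact_continuous_image continuous_intros) auto
  moreover have "{\<Sum>b\<in>insert b B. c b *\<^sub>R b |c. \<forall>b\<in>insert b B. \<bar>c b\<bar> \<le> r} =
    {x + y |x y. x \<in> ?I \<and> y \<in> ?A}" (is "?L = ?R")
  proof (intro subset_antisym subsetI)
    fix v assume "v \<in> ?L"
    then obtain c where c: "v = (\<Sum>d\<in>insert b B. c d *\<^sub>R d)" "\<forall>d\<in>insert b B. \<bar>c d\<bar> \<le> r"
      by blast
    have "v = c b *\<^sub>R b + (\<Sum>d\<in>B. c d *\<^sub>R d)"
      using insert.hyps c(1) by simp
    moreover have "c b *\<^sub>R b \<in> ?I"
      using c(2) by (intro imageI) (simp add: abs_le_iff)
    moreover have "(\<Sum>d\<in>B. c d *\<^sub>R d) \<in> ?A"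
      using c(2) by blast
    ultimately show "v \<in> ?R"
      by blast
  next
    fix v assume "v \<in> ?R"
    then obtain x y where "v = x + y" "x \<in> ?I" "y \<in> ?A"
      by blast
    then obtain t c where tc: "v = t *\<^sub>R b + (\<Sum>b\<in>B. c b *\<^sub>R b)" "t \<in> {-r..r}" "\<forall>b\<in>B. \<bar>c b\<bar> \<le> r"
      by blast
    have "(\<Sum>d\<in>B. (c(b := t)) d *\<^sub>R d) = (\<Sum>d\<in>B. c d *\<^sub>R d)"
      using insert.hyps by (intro sum.cong) auto
    then have "v = (\<Sum>d\<in>insert b B. (c(b := t)) d *\<^sub>R d)"
      using insert.hyps tc by simp
    moreover have "\<forall>d\<in>insert b B. \<bar>(c(b := t)) d\<bar> \<le> r"
      using tc by (simp add: abs_le_iff)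
    ultimately show "v \<in> ?L"
      by blast
  qed
  ultimately show ?case by simp
qed

text \<open>The vectors \<open>axis a e\<close>, with \<open>e\<close> from an orthonormal basis of
  \<open>span F\<close>, are an orthonormal basis for these tuples, and by Cauchy-Schwarz the
  coefficients of \<open>z\<close> are at most \<open>r\<close>.\<close>

lemma compact_columns_in_span:
  fixes F :: "'h::real_inner set"
  assumes "finite F"
  shows "\<exists>K. compact K \<and> (\<forall>z :: 'h ^ 'p::finite. (\<forall>a. z $ a \<in> span F) \<and> norm z \<le> r \<longrightarrow> z \<in> K)"
proof -
  have "orthonormal ({} :: 'h set)"
    by (simp add: orthonormal_def)
  then obtain E where E: "finite E" "orthonormal E" "span E = span F"
    using orthonormal_extend[of "{}" F] assms by auto
  define B :: "('h ^ 'p) set" where "B = (\<lambda>(a, e). axis a e) ` (UNIV \<times> E)"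
  have fB: "finite B"
    using E by (simp add: B_def)
  have "z \<in> {\<Sum>b\<in>B. c b *\<^sub>R b |c. \<forall>b\<in>B. \<bar>c b\<bar> \<le> r}"
    if z: "\<And>a. z $ a \<in> span F" "norm z \<le> r" for z :: "'h ^ 'p"
  proof -
    have "orthonormal B"
      using orthonormal_inner[OF E(2)] E(2)
      by (auto simp: orthonormal_def B_def pairwise_def orthogonal_def inner_axis_axis norm_axis_1
          norm_eq_1)
    have n: "norm b = 1" if "b \<in> B" for b
      using that \<open>orthonormal B\<close> by (simp add: orthonormal_def)
    have "z \<in> span B"
    proof -
      have ax: "axis a u \<in> span B" if "u \<in> span E" for a u
      proof -
        have "axis a u = (\<Sum>e\<in>E. (u \<bullet> e) *\<^sub>R (axis a e :: 'h ^ 'p))"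
          using orthonormal_expansion[OF E(2,1) that]
          by (auto simp: vec_eq_iff axis_def)
        also have "\<dots> \<in> span B"
          by (intro span_sum span_scale span_base) (auto simp: B_def)
        finally show ?thesis .
      qed
      have "z = (\<Sum>a\<in>UNIV. axis a (z $ a))"
        by (simp add: vec_eq_iff axis_def)
      also have "\<dots> \<in> span B"
        using z E by (intro span_sum ax) auto
      finally show ?thesis .
    qed
    then have "z = (\<Sum>b\<in>B. (z \<bullet> b) *\<^sub>R b)"
      using orthonormal_expansion[OF \<open>orthonormal B\<close> fB] by simp
    moreover have "\<bar>z \<bullet> b\<bar> \<le> r" if "b \<in> B" for b
      using Cauchy_Schwarz_ineq2[of z b] n[OF that] z(2) by simp
    ultimately show ?thesis
      by (intro CollectI exI[of _ "\<lambda>b. z \<bullet> b"]) blast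
  qed
  then show ?thesis
    using compact_bounded_combinations[OF fB, of r] by blast
qed


section \<open>Connecting frames by rotations\<close>

text \<open>The Stiefel manifold in terms of columns (see \<open>stiefel_columns\<close>). The trace
  form becomes the inner product of \<open>'h ^ 'p\<close> (see
  \<open>tr_inner_columns\<close>).\<close>

definition frames :: "('h::real_inner ^ 'p::finite) set"
  where "frames = {z. \<forall>a b. z $ a \<bullet> z $ b = (if a = b then 1 else 0)}"

lemma frames_inner: "z \<in> frames \<Longrightarrow> z $ a \<bullet> z $ b = (if a = b then 1 else 0)"
  by (simp add: frames_def)

lemma frames_inner_self:
  fixes z :: "'h::real_inner ^ 'p::finite"
  shows "z \<in> frames \<Longrightarrow> z \<bullet> z = CARD('p)"
  by (simp add: inner_vec_def frames_inner)

lemma frames_norm: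
  fixes z :: "'h::real_inner ^ 'p::finite"
  shows "z \<in> frames \<Longrightarrow> norm z = sqrt CARD('p)"
  by (simp add: norm_eq_sqrt_inner frames_inner_self)

lemma closed_frames: "closed (frames :: ('h::real_inner ^ 'p::finite) set)"
  unfolding frames_def by (intro closed_Collect_all closed_Collect_eq continuous_intros)

text \<open>The free parameter length \<open>T\<close> makes concatenation a mere shift, and the
  Lipschitz condition makes equidistant samples into chains with steps of order
  \<open>1 / N\<close>.\<close>

definition joined :: "'h::real_inner ^ 'p::finite \<Rightarrow> 'h ^ 'p \<Rightarrow> bool"
  where "joined x y \<longleftrightarrow> (\<exists>c (T :: real) C. 0 < T \<and> c 0 = x \<and> c T = y \<and> c ` {0..T} \<subseteq> frames \<and>
    C-lipschitz_on {0..T} c)"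

lemma joined_refl: "x \<in> frames \<Longrightarrow> joined x x"
  unfolding joined_def
  by (intro exI[of _ "\<lambda>_. x"] exI[of _ 1] exI[of _ 0]) (auto intro: lipschitz_on_constant)

lemma joined_trans:
  assumes "joined x y" "joined y z"
  shows "joined x z"
proof -
  obtain c and T C :: real where c: "0 < T" "c 0 = x" "c T = y" "c ` {0..T} \<subseteq> frames" "C-lipschitz_on {0..T} c"
    using assms(1) unfolding joined_def by blast
  obtain d and S D :: real where d: "0 < S" "d 0 = y" "d S = z" "d ` {0..S} \<subseteq> frames" "D-lipschitz_on {0..S} d"
    using assms(2) unfolding joined_def by blast
  define f where "f t = (if t \<le> T then c t else d (t - T))" for t
  have "(max C D)-lipschitz_on {0..T} c"
    using c(5) by (rule lipschitz_on_le) simp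
  moreover have "(max C D)-lipschitz_on {T..T + S} (\<lambda>t. d (t - T))"
  proof (rule lipschitz_onI)
    fix s t assume "s \<in> {T..T + S}" "t \<in> {T..T + S}"
    then have "dist (d (s - T)) (d (t - T)) \<le> D * dist (s - T) (t - T)"
      by (intro lipschitz_onD[OF d(5)]) auto
    also have "\<dots> \<le> max C D * dist s t"
      by (auto simp: dist_real_def intro: mult_right_mono)
    finally show "dist (d (s - T)) (d (t - T)) \<le> max C D * dist s t" .
  qed (use lipschitz_on_nonneg[OF d(5)] in auto)
  ultimately have "(max C D)-lipschitz_on {0..T + S} f"
    unfolding f_def using c(3) d(2) by (intro lipschitz_on_concat) auto
  moreover have "f ` {0..T + S} \<subseteq> frames"
    using c(4) d(4) by (force simp: f_def)
  ultimately show ?thesis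
    unfolding joined_def using c(1,2) d(1,3)
    by (intro exI[of _ f] exI[of _ "T + S"] exI[of _ "max C D"]) (auto simp: f_def)
qed

text \<open>For orthonormal \<open>u\<close> and \<open>w\<close> this is the rotation by
  \<open>t\<close> in their plane, from \<open>u\<close> towards \<open>w\<close>, extended by the
  identity on the orthogonal complement.\<close>

definition plane_rotation :: "'h::real_inner \<Rightarrow> 'h \<Rightarrow> real \<Rightarrow> 'h \<Rightarrow> 'h"
  where "plane_rotation u w t z = z + (cos t - 1) *\<^sub>R ((z \<bullet> u) *\<^sub>R u + (z \<bullet> w) *\<^sub>R w) +
    sin t *\<^sub>R ((z \<bullet> u) *\<^sub>R w - (z \<bullet> w) *\<^sub>R u)"

lemma plane_rotation_inner:
  assumes "u \<bullet> u = 1" "w \<bullet> w = 1" "u \<bullet> w = 0"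
  shows "plane_rotation u w t y \<bullet> plane_rotation u w t z = y \<bullet> z"
proof -
  define a b c d where "a = y \<bullet> u" and "b = y \<bullet> w" and "c = z \<bullet> u" and "d = z \<bullet> w"
  have sym: "u \<bullet> y = a" "w \<bullet> y = b" "u \<bullet> z = c" "w \<bullet> z = d" "w \<bullet> u = 0"
    using assms by (simp_all add: a_def b_def c_def d_def inner_commute)
  define C S where "C = cos t" and "S = sin t"
  \<comment> \<open>The terms linear in \<open>S\<close> cancel by antisymmetry; the rest is a
    multiple of the inner product of the planar components.\<close>
  have "plane_rotation u w t y \<bullet> plane_rotation u w t z = y \<bullet> z + (2 * (C - 1) + (C - 1)\<^sup>2 + S\<^sup>2) * (a * c + b * d)"
    unfolding plane_rotation_def C_def[symmetric] S_def[symmetric] using assms sym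
    by (simp add: inner_simps power2_eq_square flip: a_def b_def c_def d_def)
      (simp add: algebra_simps)
  moreover have "2 * (C - 1) + (C - 1)\<^sup>2 + S\<^sup>2 = 0"
    using sin_cos_squared_add[of t] by (simp add: C_def S_def power2_eq_square algebra_simps)
  ultimately show ?thesis
    by simp
qed

lemma abs_cos_diff_le: "\<bar>cos s - cos t\<bar> \<le> \<bar>s - t\<bar>" for s t :: real
  using field_differentiable_bound[of UNIV cos "\<lambda>x. - sin x" 1 s t]
  by (auto intro: derivative_eq_intros)

lemma abs_sin_diff_le: "\<bar>sin s - sin t\<bar> \<le> \<bar>s - t\<bar>" for s t :: real
  using field_differentiable_bound[of UNIV sin cos 1 s t]
  by (auto intro: derivative_eq_intros)

lemma joined_plane_rotation:
  fixes x :: "'h::real_inner ^ 'p::finite"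
  assumes x: "x \<in> frames" and uw: "u \<bullet> u = 1" "w \<bullet> w = 1" "u \<bullet> w = 0" and t: "0 \<le> t"
  shows "joined x (\<chi> b. plane_rotation u w t (x $ b))"
proof (cases "t = 0")
  \<comment> \<open>\<open>joined\<close> asks for an interval of positive length, so the angle 0 is
    served by a constant curve.\<close>
  case True
  then show ?thesis
    using joined_refl[OF x] by (simp add: plane_rotation_def)
next
  case False
  define c where "c s = (\<chi> b. plane_rotation u w s (x $ b))" for s
  define p q :: "'h ^ 'p" where
    "p = (\<chi> b. (x $ b \<bullet> u) *\<^sub>R u + (x $ b \<bullet> w) *\<^sub>R w)" and
    "q = (\<chi> b. (x $ b \<bullet> u) *\<^sub>R w - (x $ b \<bullet> w) *\<^sub>R u)"
  have c: "c s = x + (cos s - 1) *\<^sub>R p + sin s *\<^sub>R q" for s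
    by (simp add: c_def p_def q_def plane_rotation_def vec_eq_iff)
  have "(norm p + norm q)-lipschitz_on {0..t} c"
  proof (rule lipschitz_onI)
    fix r s :: real
    have "c r - c s = (cos r - cos s) *\<^sub>R p + (sin r - sin s) *\<^sub>R q"
      by (simp add: c algebra_simps)
    then have "norm (c r - c s) \<le> \<bar>cos r - cos s\<bar> * norm p + \<bar>sin r - sin s\<bar> * norm q"
      by (metis norm_scaleR norm_triangle_ineq)
    also have "\<dots> \<le> \<bar>r - s\<bar> * norm p + \<bar>r - s\<bar> * norm q"
      by (intro add_mono mult_right_mono abs_cos_diff_le abs_sin_diff_le) auto
    finally show "dist (c r) (c s) \<le> (norm p + norm q) * dist r s"
      by (simp add: dist_norm algebra_simps)
  qed simp
  moreover have "c ` {0..t} \<subseteq> frames"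
    using x by (auto simp: c_def frames_def plane_rotation_inner[OF uw])
  moreover have "c 0 = x" "c t = (\<chi> b. plane_rotation u w t (x $ b))"
    by (simp add: c) (simp add: c_def)
  ultimately show ?thesis
    unfolding joined_def using False t by (metis less_eq_real_def)
qed

text \<open>Write \<open>y $ a = \<alpha> *\<^sub>R u + \<beta> *\<^sub>R w\<close> with
  \<open>u = x $ a\<close> and \<open>w\<close> a unit vector orthogonal to \<open>u\<close> and to
  the columns already in place. Rotating all columns in the plane of \<open>u\<close> and
  \<open>w\<close> carries \<open>u\<close> to \<open>y $ a\<close> and leaves the columns in
  \<open>A\<close> fixed.\<close>

lemma joined_column:
  fixes x y :: "'h::real_inner ^ 'p::finite"
  assumes normal: "\<And>S :: 'h set. finite S \<Longrightarrow> card S \<le> CARD('p) \<Longrightarrow>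
      \<exists>e. norm e = 1 \<and> (\<forall>s\<in>S. e \<bullet> s = 0)"
    and x: "x \<in> frames" and y: "y \<in> frames" and agree: "\<And>b. b \<in> A \<Longrightarrow> x $ b = y $ b" and "a \<notin> A"
  shows "\<exists>x'\<in>frames. joined x x' \<and> (\<forall>b\<in>insert a A. x' $ b = y $ b)"
proof -
  define u \<alpha> r where "u = x $ a" and "\<alpha> = y $ a \<bullet> x $ a" and "r = y $ a - \<alpha> *\<^sub>R u"
  have uu: "u \<bullet> u = 1"
    using x by (simp add: u_def frames_inner)
  have ux: "u \<bullet> x $ b = 0" if "b \<in> A" for b
    using x that \<open>a \<notin> A\<close> by (auto simp: u_def frames_inner)
  have "\<exists>w \<beta>. norm w = 1 \<and> u \<bullet> w = 0 \<and> (\<forall>b\<in>A. w \<bullet> x $ b = 0) \<and> r = \<beta> *\<^sub>R w"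
  proof (cases "r = 0")
    case True
    \<comment> \<open>Here \<open>y $ a\<close> is a multiple of \<open>u\<close>, possibly
      \<open>- u\<close>, so the direction of rotation has to come from
      \<open>normal\<close>.\<close>
    have "card (($) x ` insert a A) \<le> CARD('p)"
      by (meson card_image_le card_mono finite_code le_trans subset_UNIV)
    then obtain e where "norm e = 1" "\<forall>s\<in>($) x ` insert a A. e \<bullet> s = 0"
      using normal[of "($) x ` insert a A"] by auto
    then show ?thesis
      using True by (intro exI[of _ e] exI[of _ 0]) (auto simp: u_def inner_commute)
  next
    case False
    have "r \<bullet> u = 0"
      using uu by (simp add: r_def inner_diff_left \<alpha>_def u_def)
    moreover have "r \<bullet> x $ b = 0" if "b \<in> A" for b
    proof -
      have "y $ a \<bullet> x $ b = 0"
        using agree[OF that] y that \<open>a \<notin> A\<close> by (auto simp: frames_inner)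
      then show ?thesis
        using ux[OF that] by (simp add: r_def inner_diff_left)
    qed
    ultimately show ?thesis
      using False
      by (intro exI[of _ "sgn r"] exI[of _ "norm r"]) (auto simp: norm_sgn sgn_div_norm inner_commute)
  qed
  then obtain w \<beta> where w: "norm w = 1" "u \<bullet> w = 0" "\<And>b. b \<in> A \<Longrightarrow> w \<bullet> x $ b = 0" "r = \<beta> *\<^sub>R w"
    by blast
  have ww: "w \<bullet> w = 1"
    using w(1) by (simp add: norm_eq_1)
  have ya: "y $ a = \<alpha> *\<^sub>R u + \<beta> *\<^sub>R w"
    using w(4) by (simp add: r_def algebra_simps)
  have "y $ a \<bullet> y $ a = \<alpha>\<^sup>2 + \<beta>\<^sup>2"
    unfolding ya using uu ww w(2) by (simp add: inner_simps inner_commute power2_eq_square)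
  then have "\<alpha>\<^sup>2 + \<beta>\<^sup>2 = 1"
    using y by (simp add: frames_inner)
  \<comment> \<open>The coefficients of the unit vector \<open>y $ a\<close> lie on the unit circle
    and so determine an angle.\<close>
  then obtain t where t: "0 \<le> t" "\<alpha> = cos t" "\<beta> = sin t"
    using sincos_total_2pi by metis
  define x' where "x' = (\<chi> b. plane_rotation u w t (x $ b))"
  have "x' $ b = y $ b" if "b \<in> A" for b
    using ux[OF that] w(3)[OF that] agree[OF that]
    by (simp add: x'_def plane_rotation_def inner_commute)
  moreover have "x' $ a = y $ a"
    unfolding ya using uu w(2) by (simp add: x'_def plane_rotation_def t inner_commute algebra_simps flip: u_def)
  moreover have "x' \<in> frames"
    using x by (simp add: x'_def frames_def plane_rotation_inner[OF uu ww w(2)])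
  ultimately show ?thesis
    using joined_plane_rotation[OF x uu ww w(2) t(1)] by (auto simp flip: x'_def)
qed

text \<open>Bring the columns into place one at a time; \<open>A\<close> collects those that already
  agree with \<open>y\<close>.\<close>

lemma frames_joined:
  fixes x y :: "'h::real_inner ^ 'p::finite"
  assumes normal: "\<And>S :: 'h set. finite S \<Longrightarrow> card S \<le> CARD('p) \<Longrightarrow>
      \<exists>e. norm e = 1 \<and> (\<forall>s\<in>S. e \<bullet> s = 0)"
    and x: "x \<in> frames" and y: "y \<in> frames"
  shows "joined x y"
proof -
  have "\<exists>x'\<in>frames. joined x x' \<and> (\<forall>b\<in>A. x' $ b = y $ b)" for A :: "'p set"
  proof (induction A rule: finite_induct[OF finite])
    case 1
    then show ?case
      using joined_refl[OF x] x by auto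
  next
    case (2 a A)
    then obtain x' where "x' \<in> frames" "joined x x'" "\<forall>b\<in>A. x' $ b = y $ b"
      by blast
    then show ?case
      using joined_column[OF normal _ y _ 2(2), of x'] joined_trans by blast
  qed
  from this[of UNIV] show ?thesis
    by (metis UNIV_I vec_eq_iff)
qed

text \<open>If \<open>S\<close> spanned the space, the dimension would be at most \<open>n\<close>,
  which is less than \<open>2 * n\<close>. So Gram-Schmidt finds a unit vector normal to
  \<open>span S\<close>.\<close>

lemma unit_normal_of_large_dim:
  fixes S :: "'h::real_inner set"
  assumes large: "(\<exists>B :: 'h set. finite B \<and> span B = UNIV) \<longrightarrow> dim (UNIV :: 'h set) \<ge> 2 * n"
    and S: "finite S" "card S \<le> n" and "0 < n"
  shows "\<exists>e. norm e = 1 \<and> (\<forall>s\<in>S. e \<bullet> s = 0)"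
proof -
  have "orthonormal ({} :: 'h set)"
    by (simp add: orthonormal_def)
  then obtain E where E: "finite E" "orthonormal E" "span E = span S" "card E \<le> card S"
    using orthonormal_extend[of "{}" S] S by auto
  have "span E \<noteq> UNIV"
  proof
    assume "span E = UNIV"
    then have "dim (UNIV :: 'h set) = dim E"
      by (metis dim_span)
    also have "\<dots> \<le> card E"
      by (rule dim_le_card'[OF E(1)])
    finally show False
      using large E S \<open>span E = UNIV\<close> \<open>0 < n\<close> by fastforce
  qed
  then obtain z where "z \<notin> span E"
    by blast
  then obtain e where "norm e = 1" "\<And>u. u \<in> span E \<Longrightarrow> e \<bullet> u = 0"
    using unit_normal_exists[OF E(2,1)] by blast
  then show ?thesis
    using E(3) span_base by blast
qed


section \<open>The discrete Euler--Lagrange equation\<close>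

text \<open>The composition \<open>x \<circ> u\<^sup>t \<circ> v\<close>, with elements of \<open>L(\<real>\<^sup>p, \<bbbH>)\<close> written as tuples of columns.\<close>

definition triple :: "'h::real_inner ^ 'p::finite \<Rightarrow> 'h ^ 'p \<Rightarrow> 'h ^ 'p \<Rightarrow> 'h ^ 'p"
  where "triple x u v = (\<chi> a. \<Sum>b\<in>UNIV. (u $ b \<bullet> v $ a) *\<^sub>R x $ b)"

lemma triple_nth: "triple x u v $ a = (\<Sum>b\<in>UNIV. (u $ b \<bullet> v $ a) *\<^sub>R x $ b)"
  by (simp add: triple_def)

lemma triple_simps:
  "triple (x + x') u v = triple x u v + triple x' u v"
  "triple (x - x') u v = triple x u v - triple x' u v"
  "triple x (u + u') v = triple x u v + triple x u' v"
  "triple x (u - u') v = triple x u v - triple x u' v"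
  "triple x u (v + v') = triple x u v + triple x u v'"
  "triple x u (v - v') = triple x u v - triple x u v'"
  "triple (r *\<^sub>R x) u v = r *\<^sub>R triple x u v"
  "triple x (r *\<^sub>R u) v = r *\<^sub>R triple x u v"
  "triple x u (r *\<^sub>R v) = r *\<^sub>R triple x u v"
  by (simp_all add: vec_eq_iff triple_nth sum.distrib sum_subtractf inner_add_left inner_add_right
      inner_diff_left inner_diff_right scaleR_add_left scaleR_diff_left scaleR_add_right
      scaleR_diff_right scaleR_sum_right mult.commute)

lemma norm_vec_le_sum: "norm (x :: 'a::real_normed_vector ^ 'n::finite) \<le> (\<Sum>a\<in>UNIV. norm (x $ a))"
  unfolding norm_vec_def by (rule L2_set_le_sum) simp

lemma norm_triple_le:
  fixes x :: "'h::real_inner ^ 'p::finite"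
  shows "norm (triple x u v) \<le> (CARD('p))\<^sup>2 * norm x * norm u * norm v"
proof -
  have "norm ((u $ b \<bullet> v $ a) *\<^sub>R x $ b) \<le> norm x * norm u * norm v" for a b
  proof -
    have "\<bar>u $ b \<bullet> v $ a\<bar> * norm (x $ b) \<le> (norm (u $ b) * norm (v $ a)) * norm (x $ b)"
      by (intro mult_right_mono Cauchy_Schwarz_ineq2) simp
    also have "\<dots> \<le> (norm u * norm v) * norm x"
      by (intro mult_mono Finite_Cartesian_Product.norm_nth_le) auto
    finally show ?thesis
      by (simp add: mult_ac)
  qed
  then have "norm (triple x u v $ a) \<le> CARD('p) * (norm x * norm u * norm v)" for a
    unfolding triple_nth by (intro sum_norm_bound) auto
  then have "norm (triple x u v) \<le> (\<Sum>a\<in>(UNIV :: 'p set). CARD('p) * (norm x * norm u * norm v))"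
    by (intro order.trans[OF norm_vec_le_sum] sum_mono)
  then show ?thesis
    by (simp add: power2_eq_square mult_ac)
qed

lemma norm_triple_diff_le:
  fixes x x' :: "'h::real_inner ^ 'p::finite"
  assumes "norm x' \<le> s" "norm v \<le> D" "norm v' \<le> D"
  shows "norm (triple x v v - triple x' v' v') \<le>
    (CARD('p))\<^sup>2 * (D\<^sup>2 * norm (x - x') + 2 * s * D * norm (v - v'))"
proof -
  let ?c = "(CARD('p))\<^sup>2 :: real"
  have "0 \<le> D" "0 \<le> s"
    using assms norm_ge_zero order_trans by blast+
  \<comment> \<open>Replace one argument at a time.\<close>
  have "triple x v v - triple x' v' v' =
      triple (x - x') v v + triple x' (v - v') v + triple x' v' (v - v')"
    by (simp add: triple_simps)
  then have "norm (triple x v v - triple x' v' v') \<le> norm (triple (x - x') v v) +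
      norm (triple x' (v - v') v) + norm (triple x' v' (v - v'))"
    by (metis norm_triangle_mono norm_triangle_ineq order_refl)
  also have "\<dots> \<le> ?c * norm (x - x') * D * D + ?c * s * norm (v - v') * D + ?c * s * D * norm (v - v')"
    using assms \<open>0 \<le> D\<close> \<open>0 \<le> s\<close>
    by (intro add_mono order_trans[OF norm_triple_le] mult_mono) auto
  finally show ?thesis
    by (simp add: algebra_simps power2_eq_square)
qed

text \<open>Expand the Gram matrix of \<open>y - x\<close>: since those of \<open>x\<close> and
  \<open>y\<close> are the identity, the symmetric part of \<open>x\<^sup>t y\<close> is determined
  by the chord alone.\<close>

lemma frames_polar:
  assumes "x \<in> frames" "y \<in> frames"
  shows "x $ b \<bullet> y $ a + x $ a \<bullet> y $ b = (if a = b then 2 else 0) - (y - x) $ b \<bullet> (y - x) $ a"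
  using frames_inner[OF assms(1), of b a] frames_inner[OF assms(2), of b a]
  by (auto simp: inner_diff_left inner_diff_right inner_commute)

text \<open>The matrix \<open>v\<^sup>t v\<close> is symmetric, so only the symmetric part of
  \<open>x\<^sup>t w\<close> contributes.\<close>

lemma triple_inner:
  "triple x v v \<bullet> w = (\<Sum>a\<in>UNIV. \<Sum>b\<in>UNIV. (v $ b \<bullet> v $ a) * (x $ b \<bullet> w $ a + x $ a \<bullet> w $ b)) / 2"
proof -
  have 1: "triple x v v \<bullet> w = (\<Sum>a\<in>UNIV. \<Sum>b\<in>UNIV. (v $ b \<bullet> v $ a) * (x $ b \<bullet> w $ a))"
    by (simp add: inner_vec_def triple_nth inner_sum_left)
  also have "\<dots> = (\<Sum>a\<in>UNIV. \<Sum>b\<in>UNIV. (v $ b \<bullet> v $ a) * (x $ a \<bullet> w $ b))"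
    by (subst sum.swap) (simp add: inner_commute)
  finally show ?thesis
    using 1 by (simp add: distrib_left sum.distrib)
qed

text \<open>A chord is tangential up to second order: the symmetric part of
  \<open>x\<^sup>t (z - x)\<close> is minus half the Gram matrix of \<open>z - x\<close>.\<close>

lemma triple_chord_small:
  fixes x z :: "'h::real_inner ^ 'p::finite"
  assumes "x \<in> frames" "z \<in> frames"
  shows "\<bar>triple x v v \<bullet> (z - x)\<bar> \<le> (CARD('p))\<^sup>2 * (norm v)\<^sup>2 * (norm (z - x))\<^sup>2 / 2"
proof -
  let ?w = "z - x"
  have sym: "x $ b \<bullet> ?w $ a + x $ a \<bullet> ?w $ b = - (?w $ b \<bullet> ?w $ a)" for a b
    using frames_polar[OF assms, of b a] frames_inner[OF assms(1), of a b] frames_inner[OF assms(1), of b a]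
    by (auto simp: inner_diff_right)
  have "\<bar>(v $ b \<bullet> v $ a) * (x $ b \<bullet> ?w $ a + x $ a \<bullet> ?w $ b)\<bar> \<le> (norm v)\<^sup>2 * (norm ?w)\<^sup>2" for a b
  proof -
    have cs: "\<bar>u $ b \<bullet> u $ a\<bar> \<le> (norm u)\<^sup>2" for u :: "'h ^ 'p"
      using Cauchy_Schwarz_ineq2[of "u $ b" "u $ a"]
        mult_mono[OF Finite_Cartesian_Product.norm_nth_le[of u b] Finite_Cartesian_Product.norm_nth_le[of u a]]
      by (simp add: power2_eq_square)
    show ?thesis
      unfolding sym abs_mult abs_minus_cancel by (intro mult_mono cs) auto
  qed
  then have "\<bar>\<Sum>b\<in>UNIV. (v $ b \<bullet> v $ a) * (x $ b \<bullet> ?w $ a + x $ a \<bullet> ?w $ b)\<bar> \<le>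
      CARD('p) * ((norm v)\<^sup>2 * (norm ?w)\<^sup>2)" for a
    using sum_norm_bound[of UNIV "\<lambda>b. (v $ b \<bullet> v $ a) * (x $ b \<bullet> ?w $ a + x $ a \<bullet> ?w $ b)"]
    unfolding real_norm_def by auto
  then have "\<bar>\<Sum>a\<in>UNIV. \<Sum>b\<in>UNIV. (v $ b \<bullet> v $ a) * (x $ b \<bullet> ?w $ a + x $ a \<bullet> ?w $ b)\<bar> \<le>
      CARD('p) * (CARD('p) * ((norm v)\<^sup>2 * (norm ?w)\<^sup>2))"
    using sum_norm_bound[of UNIV
        "\<lambda>a. \<Sum>b\<in>UNIV. (v $ b \<bullet> v $ a) * (x $ b \<bullet> ?w $ a + x $ a \<bullet> ?w $ b)"]
    unfolding real_norm_def by auto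
  then show ?thesis
    unfolding triple_inner by (simp add: power2_eq_square mult_ac)
qed

text \<open>The first-order condition at \<open>t = 0\<close>: some angle attains the value
  \<open>r = sqrt (\<alpha>\<^sup>2 + \<beta>\<^sup>2)\<close>, which exceeds
  \<open>\<alpha>\<close> unless \<open>\<beta>\<close> vanishes.\<close>

lemma trig_maximum:
  fixes \<alpha> \<beta> :: real
  assumes "\<And>t. \<alpha> * cos t + \<beta> * sin t \<le> \<alpha>"
  shows "\<beta> = 0"
proof (rule ccontr)
  assume "\<beta> \<noteq> 0"
  define r where "r = sqrt (\<alpha>\<^sup>2 + \<beta>\<^sup>2)"
  have r: "r\<^sup>2 = \<alpha>\<^sup>2 + \<beta>\<^sup>2" "0 < r"
    using \<open>\<beta> \<noteq> 0\<close> by (auto simp: r_def add_nonneg_pos)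
  then have "(\<alpha> / r)\<^sup>2 + (\<beta> / r)\<^sup>2 = 1"
    unfolding power_divide add_divide_distrib[symmetric] r(1)[symmetric] by simp
  then obtain t where "\<alpha> / r = cos t" "\<beta> / r = sin t"
    using sincos_total_2pi by metis
  then have "\<alpha> * cos t + \<beta> * sin t = r\<^sup>2 / r"
    using r by (metis add_divide_distrib power2_eq_square times_divide_eq_right)
  then have "r \<le> \<alpha>"
    using assms[of t] r(2) by (simp add: power2_eq_square)
  then have "r\<^sup>2 \<le> \<alpha>\<^sup>2"
    using r(2) by (intro power_mono) auto
  then show False
    using r(1) \<open>\<beta> \<noteq> 0\<close> by simp
qed

text \<open>Rotating all columns of \<open>x\<close> in the plane of \<open>u\<close> and
  \<open>v\<close> changes the pairing with \<open>w\<close> by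
  \<open>(cos t - 1) * ?p + sin t * ?q\<close>. Maximality at \<open>t = 0\<close> forces
  \<open>?q = 0\<close>.\<close>

lemma frames_maximizer_plane:
  fixes x w :: "'h::real_inner ^ 'p::finite"
  assumes x: "x \<in> frames" and max: "\<And>z. z \<in> frames \<Longrightarrow> z \<bullet> w \<le> x \<bullet> w"
    and uv: "u \<bullet> u = 1" "v \<bullet> v = 1" "u \<bullet> v = 0"
  shows "(\<Sum>c\<in>UNIV. (x $ c \<bullet> u) * (v \<bullet> w $ c) - (x $ c \<bullet> v) * (u \<bullet> w $ c)) = 0"
proof (rule trig_maximum)
  let ?p = "\<Sum>c\<in>UNIV. (x $ c \<bullet> u) * (u \<bullet> w $ c) + (x $ c \<bullet> v) * (v \<bullet> w $ c)"
  let ?q = "\<Sum>c\<in>UNIV. (x $ c \<bullet> u) * (v \<bullet> w $ c) - (x $ c \<bullet> v) * (u \<bullet> w $ c)"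
  fix t
  have "(\<chi> c. plane_rotation u v t (x $ c)) \<in> frames"
    using x by (simp add: frames_def plane_rotation_inner[OF uv])
  then have "(\<chi> c. plane_rotation u v t (x $ c)) \<bullet> w \<le> x \<bullet> w"
    by (rule max)
  moreover have "(\<chi> c. plane_rotation u v t (x $ c)) \<bullet> w = x \<bullet> w + (cos t - 1) * ?p + sin t * ?q"
    unfolding inner_vec_def sum_distrib_left sum.distrib[symmetric]
    by (intro sum.cong) (simp_all add: plane_rotation_def inner_simps)
  ultimately show "?p * cos t + ?q * sin t \<le> ?p"
    by (simp add: algebra_simps)
qed

text \<open>The Lagrange condition \<open>w = x (x\<^sup>t w)\<close> with a symmetric multiplier
  \<open>x\<^sup>t w\<close>. Rotations in the plane of two columns give the symmetry; rotating a
  column towards the residual \<open>r\<close> of its projection gives \<open>r = 0\<close>.\<close>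

lemma frames_maximizer:
  fixes x w :: "'h::real_inner ^ 'p::finite"
  assumes x: "x \<in> frames" and max: "\<And>z. z \<in> frames \<Longrightarrow> z \<bullet> w \<le> x \<bullet> w"
  shows "x $ b \<bullet> w $ a = x $ a \<bullet> w $ b" "w $ a = (\<Sum>b\<in>UNIV. (x $ b \<bullet> w $ a) *\<^sub>R x $ b)"
proof -
  have x1: "x $ c \<bullet> x $ d = (if c = d then 1 else 0)" for c d
    using frames_inner[OF x] .
  show "x $ b \<bullet> w $ a = x $ a \<bullet> w $ b"
  proof (cases "a = b")
    case False
    have "(\<Sum>c\<in>UNIV. (x $ c \<bullet> x $ a) * (x $ b \<bullet> w $ c) - (x $ c \<bullet> x $ b) * (x $ a \<bullet> w $ c)) = 0"
      using False by (intro frames_maximizer_plane[OF x max]) (auto simp: x1)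
    then show ?thesis
      by (simp add: x1 sum_subtractf if_distrib[of "\<lambda>r. r * _"] cong: if_cong)
  qed simp
  define r where "r = w $ a - (\<Sum>b\<in>UNIV. (x $ b \<bullet> w $ a) *\<^sub>R x $ b)"
  have rx: "r \<bullet> x $ c = 0" for c
    by (simp add: r_def inner_diff_left inner_sum_left x1 if_distrib cong: if_cong)
      (simp add: inner_commute)
  have "r = 0"
  proof (rule ccontr)
    assume "r \<noteq> 0"
    then have e: "sgn r \<bullet> sgn r = 1"
      by (simp add: norm_eq_1[symmetric] norm_sgn)
    have ex: "x $ c \<bullet> sgn r = 0" "sgn r \<bullet> x $ c = 0" for c
      using rx by (simp_all add: sgn_div_norm inner_commute)
    have "(\<Sum>c\<in>UNIV. (x $ c \<bullet> x $ a) * (sgn r \<bullet> w $ c) - (x $ c \<bullet> sgn r) * (x $ a \<bullet> w $ c)) = 0"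
      using e ex by (intro frames_maximizer_plane[OF x max]) (auto simp: x1)
    then have "sgn r \<bullet> w $ a = 0"
      by (simp add: x1 ex if_distrib[of "\<lambda>r. r * _"] cong: if_cong)
    then have "r \<bullet> w $ a = 0"
      using \<open>r \<noteq> 0\<close> by (simp add: sgn_div_norm)
    then have "r \<bullet> r = 0"
      by (subst (2) r_def) (simp add: inner_diff_right inner_sum_right rx)
    then show False
      using \<open>r \<noteq> 0\<close> by simp
  qed
  then show "w $ a = (\<Sum>b\<in>UNIV. (x $ b \<bullet> w $ a) *\<^sub>R x $ b)"
    by (simp add: r_def)
qed

section \<open>Chains, their energy and the Euler-Lagrange recursion\<close>

definition chains :: "'h::real_inner ^ 'p::finite \<Rightarrow> 'h ^ 'p \<Rightarrow> nat \<Rightarrow> (nat \<Rightarrow> 'h ^ 'p) set"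
  where "chains x y N = {z. z 0 = x \<and> z N = y \<and> (\<forall>i\<le>N. z i \<in> frames)}"

text \<open>Squared steps make the energy affine in each interior vertex, because all frames have
  the same norm; they also keep the steps of a minimizer nearly equal.\<close>

definition chain_energy :: "nat \<Rightarrow> (nat \<Rightarrow> 'h::real_inner ^ 'p::finite) \<Rightarrow> real"
  where "chain_energy N z = (\<Sum>i<N. (norm (z (Suc i) - z i))\<^sup>2)"

definition minimal_chain :: "'h::real_inner ^ 'p::finite \<Rightarrow> 'h ^ 'p \<Rightarrow> nat \<Rightarrow> (nat \<Rightarrow> 'h ^ 'p) \<Rightarrow> bool"
  where "minimal_chain x y N z \<longleftrightarrow> z \<in> chains x y N \<and>
    (\<forall>w\<in>chains x y N. chain_energy N z \<le> chain_energy N w)"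

lemma minimal_chain_frames: "minimal_chain x y N z \<Longrightarrow> i \<le> N \<Longrightarrow> z i \<in> frames"
  by (simp add: minimal_chain_def chains_def)

text \<open>Replacing one vertex by \<open>u\<close> changes two terms of the energy. As
  \<open>u\<close> has the norm of the old vertex, only the pairing with the sum of the two
  neighbours matters.\<close>

lemma minimal_chain_maximizer:
  assumes z: "minimal_chain x y N z" and j: "Suc j < N" and u: "u \<in> frames"
  shows "u \<bullet> (z (Suc (Suc j)) + z j) \<le> z (Suc j) \<bullet> (z (Suc (Suc j)) + z j)"
proof -
  define w where "w = z(Suc j := u)"
  have "w \<in> chains x y N"
    using z u j by (auto simp: w_def minimal_chain_def chains_def)
  then have le: "chain_energy N z \<le> chain_energy N w"
    using z by (simp add: minimal_chain_def)
  have split: "chain_energy N f = (\<Sum>i\<in>{..<N} - {j, Suc j}. (norm (f (Suc i) - f i))\<^sup>2) +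
      ((norm (f (Suc j) - f j))\<^sup>2 + (norm (f (Suc (Suc j)) - f (Suc j)))\<^sup>2)" for f :: "nat \<Rightarrow> 'a ^ 'b"
    unfolding chain_energy_def using j
    by (subst sum.subset_diff[of "{j, Suc j}"]) auto
  have rest: "(\<Sum>i\<in>{..<N} - {j, Suc j}. (norm (w (Suc i) - w i))\<^sup>2) =
      (\<Sum>i\<in>{..<N} - {j, Suc j}. (norm (z (Suc i) - z i))\<^sup>2)"
    by (intro sum.cong) (auto simp: w_def)
  have uu: "u \<bullet> u = z (Suc j) \<bullet> z (Suc j)"
    using u minimal_chain_frames[OF z, of "Suc j"] j by (simp add: frames_inner_self)
  have "(norm (z (Suc j) - z j))\<^sup>2 + (norm (z (Suc (Suc j)) - z (Suc j)))\<^sup>2 \<le>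
      (norm (u - z j))\<^sup>2 + (norm (z (Suc (Suc j)) - u))\<^sup>2"
    using le unfolding split[of z] split[of w] rest by (simp add: w_def)
  then show ?thesis
    using uu by (simp add: power2_norm_eq_inner inner_simps inner_commute)
qed

text \<open>The second difference of a minimal chain is normal to the Stiefel manifold, and its normal
  component is determined by the constraint alone.\<close>

lemma minimal_chain_step:
  fixes z :: "nat \<Rightarrow> 'h::real_inner ^ 'p::finite"
  assumes z: "minimal_chain x y N z" and j: "Suc j < N"
  defines "\<Delta> \<equiv> \<lambda>i. z (Suc i) - z i"
  shows "\<Delta> (Suc j) - \<Delta> j = - (1/2) *\<^sub>R
    (triple (z (Suc j)) (\<Delta> (Suc j)) (\<Delta> (Suc j)) + triple (z (Suc j)) (\<Delta> j) (\<Delta> j))"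
proof -
  define x0 w where "x0 = z (Suc j)" and "w = z (Suc (Suc j)) + z j"
  have fr: "z j \<in> frames" "x0 \<in> frames" "z (Suc (Suc j)) \<in> frames"
    using minimal_chain_frames[OF z] j by (auto simp: x0_def)
  note max = frames_maximizer[OF fr(2) minimal_chain_maximizer[OF z j, folded x0_def w_def]]
  \<comment> \<open>The multiplier is symmetric, so twice a coefficient is its symmetrization, which
    \<open>frames_polar\<close> expresses through the two adjacent chords.\<close>
  have coef: "x0 $ b \<bullet> w $ a = (if a = b then 2 else 0) -
      (1/2) * (\<Delta> (Suc j) $ b \<bullet> \<Delta> (Suc j) $ a + \<Delta> j $ b \<bullet> \<Delta> j $ a)" for a b
  proof -
    have "2 * (x0 $ b \<bullet> w $ a) = (x0 $ b \<bullet> z (Suc (Suc j)) $ a + x0 $ a \<bullet> z (Suc (Suc j)) $ b) +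
      (x0 $ b \<bullet> z j $ a + x0 $ a \<bullet> z j $ b)"
      using max(1)[of b a] by (simp add: w_def inner_add_right)
    also have "\<dots> = 2 * (if a = b then 2 else 0) -
        (\<Delta> (Suc j) $ b \<bullet> \<Delta> (Suc j) $ a + \<Delta> j $ b \<bullet> \<Delta> j $ a)"
      unfolding frames_polar[OF fr(2,3)] frames_polar[OF fr(2,1)]
      by (simp add: \<Delta>_def x0_def inner_diff_left inner_diff_right)
    finally show ?thesis
      by (cases "a = b"; simp add: field_simps)
  qed
  have "w $ a = 2 *\<^sub>R x0 $ a -
      (1/2) *\<^sub>R (triple x0 (\<Delta> (Suc j)) (\<Delta> (Suc j)) + triple x0 (\<Delta> j) (\<Delta> j)) $ a" for a
  proof -
    have "w $ a = (\<Sum>b\<in>UNIV. (x0 $ b \<bullet> w $ a) *\<^sub>R x0 $ b)"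
      by (rule max(2))
    also have "\<dots> = (\<Sum>b\<in>UNIV. (if a = b then 2 *\<^sub>R x0 $ b else 0) -
      (1/2) *\<^sub>R ((\<Delta> (Suc j) $ b \<bullet> \<Delta> (Suc j) $ a) *\<^sub>R x0 $ b + (\<Delta> j $ b \<bullet> \<Delta> j $ a) *\<^sub>R x0 $ b))"
      unfolding coef by (intro sum.cong) (auto simp: algebra_simps)
    also have "\<dots> = 2 *\<^sub>R x0 $ a -
      (1/2) *\<^sub>R (triple x0 (\<Delta> (Suc j)) (\<Delta> (Suc j)) + triple x0 (\<Delta> j) (\<Delta> j)) $ a"
      by (simp add: sum_subtractf triple_nth flip: scaleR_sum_right) (simp add: sum.distrib)
    finally show ?thesis .
  qed
  then have "w = 2 *\<^sub>R x0 - (1/2) *\<^sub>R (triple x0 (\<Delta> (Suc j)) (\<Delta> (Suc j)) + triple x0 (\<Delta> j) (\<Delta> j))"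
    by (simp add: vec_eq_iff)
  moreover have "\<Delta> (Suc j) - \<Delta> j = w - 2 *\<^sub>R x0"
    by (simp add: \<Delta>_def w_def x0_def algebra_simps scaleR_2)
  ultimately show ?thesis
    by (simp add: x0_def)
qed

text \<open>The recursion is implicit, with the new vertex on its right-hand side too, but there it
  enters only scalar coefficients: the columns of \<open>triple\<close> are combinations of those of
  its first argument, the middle vertex.\<close>

lemma minimal_chain_span:
  fixes z :: "nat \<Rightarrow> 'h::real_inner ^ 'p::finite"
  assumes z: "minimal_chain x y N z" and i: "i \<le> N"
  shows "z i $ a \<in> span (range (($) (z 0)) \<union> range (($) (z 1)))"
  using i
proof (induction i arbitrary: a rule: less_induct)
  case (less i)
  let ?S = "span (range (($) (z 0)) \<union> range (($) (z 1)))"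
  show ?case
  proof (cases "i \<le> 1")
    case True
    then have "i = 0 \<or> i = 1"
      by auto
    then show ?thesis
      by (auto intro: span_base)
  next
    case False
    then obtain j where ij: "i = Suc (Suc j)"
      by (metis One_nat_def Suc_le_mono le0 not0_implies_Suc)
    have "z (Suc j) $ b \<in> ?S" "z j $ b \<in> ?S" for b
      using less ij by auto
    moreover have tri: "triple v u w $ b \<in> ?S" if "\<And>c. v $ c \<in> ?S" for v u w :: "'h ^ 'p" and b
      using that unfolding triple_nth by (intro span_sum span_scale) auto
    moreover have "z i $ a = 2 *\<^sub>R z (Suc j) $ a - z j $ a +
        (z (Suc (Suc j)) - z (Suc j) - (z (Suc j) - z j)) $ a"
      by (simp add: ij scaleR_2)
    ultimately show ?thesis
      using minimal_chain_step[OF z, of j] less.prems unfolding ij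
      by (simp add: span_add span_diff span_scale del: vector_minus_component)
  qed
qed


section \<open>Existence of minimal chains\<close>

text \<open>Applied column by column, an isometry preserves Gram matrices, hence frames; differences
  of columns stay in \<open>V\<close>, so step lengths are preserved as well.\<close>

lemma chain_compression:
  fixes z :: "nat \<Rightarrow> 'h::real_inner ^ 'p::finite"
  assumes z: "z \<in> chains x y N" and T: "linear T"
    and iso: "\<And>u v. u \<in> V \<Longrightarrow> v \<in> V \<Longrightarrow> T u \<bullet> T v = u \<bullet> v"
    and V: "subspace V" "\<And>i a. i \<le> N \<Longrightarrow> z i $ a \<in> V"
    and fix_x: "\<And>a. T (x $ a) = x $ a" and fix_y: "\<And>a. T (y $ a) = y $ a"
  defines "w \<equiv> \<lambda>i. \<chi> a. T (z i $ a)"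
  shows "w \<in> chains x y N" "chain_energy N w = chain_energy N z"
proof -
  show "w \<in> chains x y N"
    using z iso[OF V(2) V(2)] fix_x fix_y
    by (auto simp: chains_def frames_def w_def vec_eq_iff)
  have "(norm (w (Suc i) - w i))\<^sup>2 = (norm (z (Suc i) - z i))\<^sup>2" if "i < N" for i
  proof -
    have d: "z (Suc i) $ a - z i $ a \<in> V" for a
      using V that by (intro subspace_diff) auto
    have "(w (Suc i) - w i) $ a = T (z (Suc i) $ a - z i $ a)" for a
      by (simp add: w_def linear_diff[OF T])
    then show ?thesis
      using iso[OF d d] by (simp add: power2_norm_eq_inner inner_vec_def)
  qed
  then show "chain_energy N w = chain_energy N z"
    by (simp add: chain_energy_def)
qed

lemma compact_PiE_UNIV:
  fixes K :: "'i \<Rightarrow> 'a::topological_space set"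
  assumes "\<And>i. compact (K i)"
  shows "compact {f. \<forall>i. f i \<in> K i}"
proof -
  have "compactin (product_topology (\<lambda>_. euclidean) UNIV) (PiE UNIV K)"
    using assms by (subst compactin_PiE) simp
  moreover have "PiE UNIV K = {f. \<forall>i. f i \<in> K i}"
    by (auto simp: PiE_def Pi_def)
  ultimately show ?thesis
    by (simp add: euclidean_product_topology)
qed

lemma minimal_chain_exists:
  fixes x y :: "'h::real_inner ^ 'p::finite"
  assumes N: "0 < N" and ne: "chains x y N \<noteq> {}"
  shows "\<exists>z. minimal_chain x y N z"
proof -
  let ?U = "range (($) x) \<union> range (($) y)"
  \<comment> \<open>A chain consists of \<open>Suc N\<close> frames with \<open>CARD('p)\<close>
    columns each.\<close>
  obtain F where F: "finite F" and compr: "\<And>Z. finite Z \<Longrightarrow> card Z \<le> Suc N * CARD('p) \<Longrightarrow>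
      \<exists>T. linear T \<and> (\<forall>u\<in>span (?U \<union> Z). \<forall>v\<in>span (?U \<union> Z). T u \<bullet> T v = u \<bullet> v) \<and>
        (\<forall>u\<in>?U. T u = u) \<and> (\<forall>u. T u \<in> span F)"
    using isometric_compression[of ?U "Suc N * CARD('p)"] by auto
  obtain K :: "('h ^ 'p) set" where K: "compact K"
    "\<And>z. (\<And>a. z $ a \<in> span F) \<Longrightarrow> norm z \<le> sqrt CARD('p) \<Longrightarrow> z \<in> K"
    using compact_columns_in_span[OF F, of "sqrt CARD('p)"] by blast
  \<comment> \<open>Indices beyond \<open>N\<close> are confined to a compact set too, so that
    \<open>A\<close> is compact by Tychonoff's theorem.\<close>
  define L where "L i = (if i = 0 then {x} else if i = N then {y} else K \<inter> frames)" for i :: nat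
  define A where "A = {z. \<forall>i. z i \<in> L i}"
  have x: "x \<in> frames" and y: "y \<in> frames"
    using ne by (auto simp: chains_def)
  have sub: "A \<subseteq> chains x y N"
    using x y N by (auto simp: A_def L_def chains_def split: if_splits)
  have compress: "\<exists>w\<in>A. chain_energy N w = chain_energy N z" if z: "z \<in> chains x y N" for z
  proof -
    define Z where "Z = (\<Union>i\<in>{..N}. range (($) (z i)))"
    have fin: "finite Z"
      by (simp add: Z_def)
    have "card Z \<le> (\<Sum>i\<in>{..N}. card (range (($) (z i))))"
      unfolding Z_def by (rule card_UN_le) simp
    also have "\<dots> \<le> (\<Sum>i\<in>{..N}. CARD('p))"
      by (intro sum_mono card_image_le) simp
    finally have "card Z \<le> Suc N * CARD('p)"
      by simp
    then obtain T where T: "linear T" "\<And>u v. u \<in> span (?U \<union> Z) \<Longrightarrow> v \<in> span (?U \<union> Z) \<Longrightarrow> T u \<bullet> T v = u \<bullet> v"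
      "\<And>u. u \<in> ?U \<Longrightarrow> T u = u" "\<And>u. T u \<in> span F"
      using compr[OF fin] by blast
    define w0 where "w0 i = (\<chi> a. T (z i $ a))" for i
    have zV: "z i $ a \<in> span (?U \<union> Z)" if "i \<le> N" for i a
      using that unfolding Z_def by (intro span_base UnI2 UN_I[of i] rangeI) auto
    then have w0: "w0 \<in> chains x y N" "chain_energy N w0 = chain_energy N z"
      using chain_compression[OF z T(1,2) subspace_span zV T(3) T(3)] unfolding w0_def by auto
    have "w0 i \<in> K" if "i \<le> N" for i
    proof (rule K(2))
      show "norm (w0 i) \<le> sqrt CARD('p)"
        using w0(1) that frames_norm[of "w0 i"] by (simp add: chains_def)
    qed (simp add: w0_def T(4))
    then have w0L: "w0 i \<in> L i" "w0 i \<in> K \<inter> frames" if "i \<le> N" for i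
      using w0(1) that by (auto simp: L_def chains_def)
    \<comment> \<open>The chain continues constantly after \<open>N\<close>; this puts it into
      \<open>A\<close> and leaves the energy unchanged.\<close>
    define w where "w i = w0 (min i N)" for i
    have "w i \<in> L i" for i
    proof (cases "i \<le> N")
      case True
      then show ?thesis
        using w0L by (simp add: w_def min_absorb1)
    next
      case False
      then show ?thesis
        using w0L(2)[of N] N by (simp add: w_def L_def)
    qed
    then have "w \<in> A"
      by (simp add: A_def)
    moreover have "chain_energy N w = chain_energy N w0"
      unfolding chain_energy_def by (intro sum.cong) (auto simp: w_def)
    ultimately show ?thesis
      using w0(2) by auto
  qed
  have "compact (L i)" for i
    using K(1) closed_frames by (auto simp: L_def intro: compact_Int_closed)
  then have "compact A"
    unfolding A_def by (rule compact_PiE_UNIV)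
  moreover have "A \<noteq> {}"
    using ne compress by blast
  moreover have "continuous_on A (chain_energy N)"
    unfolding chain_energy_def
    by (intro continuous_intros continuous_on_subset[OF continuous_on_product_coordinates]) auto
  ultimately obtain z where "z \<in> A" "\<And>w. w \<in> A \<Longrightarrow> chain_energy N z \<le> chain_energy N w"
    by (metis continuous_attains_inf)
  then have "minimal_chain x y N z"
    unfolding minimal_chain_def using sub compress by (metis subsetD)
  then show ?thesis
    by blast
qed

text \<open>By \<open>minimal_chain_span\<close> the whole chain lies in the span of the columns of
  \<open>x\<close> and \<open>z 1\<close>, so besides \<open>x\<close> and \<open>y\<close> only
  \<open>CARD('p)\<close> vectors have to be moved, whatever \<open>N\<close> is. Preserving the
  energy preserves minimality.\<close>

lemma minimal_chains_in_fixed_span: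
  fixes x y :: "'h::real_inner ^ 'p::finite"
  assumes ne: "\<And>N. 0 < N \<Longrightarrow> chains x y N \<noteq> {}"
  shows "\<exists>F. finite F \<and> (\<forall>N>0. \<exists>z. minimal_chain x y N z \<and> (\<forall>i\<le>N. \<forall>a. z i $ a \<in> span F))"
proof -
  let ?U = "range (($) x) \<union> range (($) y)"
  obtain F where F: "finite F" and compr: "\<And>Z. finite Z \<Longrightarrow> card Z \<le> CARD('p) \<Longrightarrow>
      \<exists>T. linear T \<and> (\<forall>u\<in>span (?U \<union> Z). \<forall>v\<in>span (?U \<union> Z). T u \<bullet> T v = u \<bullet> v) \<and>
        (\<forall>u\<in>?U. T u = u) \<and> (\<forall>u. T u \<in> span F)"
    using isometric_compression[of ?U "CARD('p)"] by auto
  have "\<exists>z. minimal_chain x y N z \<and> (\<forall>i\<le>N. \<forall>a. z i $ a \<in> span F)" if N: "0 < N" for N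
  proof -
    obtain z where z: "minimal_chain x y N z"
      using minimal_chain_exists[OF N ne[OF N]] by blast
    have z0: "z 0 = x" "z \<in> chains x y N"
      using z by (auto simp: minimal_chain_def chains_def)
    let ?Z = "range (($) (z 1))"
    obtain T where T: "linear T" "\<And>u v. u \<in> span (?U \<union> ?Z) \<Longrightarrow> v \<in> span (?U \<union> ?Z) \<Longrightarrow> T u \<bullet> T v = u \<bullet> v"
      "\<And>u. u \<in> ?U \<Longrightarrow> T u = u" "\<And>u. T u \<in> span F"
      using compr[of ?Z] card_image_le[of UNIV "($) (z 1)"] by auto
    have zV: "z i $ a \<in> span (?U \<union> ?Z)" if "i \<le> N" for i a
      using minimal_chain_span[OF z that, of a] z0 span_mono[of "range (($) x) \<union> ?Z" "?U \<union> ?Z"]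
      by auto
    then have "(\<lambda>i. \<chi> a. T (z i $ a)) \<in> chains x y N"
      "chain_energy N (\<lambda>i. \<chi> a. T (z i $ a)) = chain_energy N z"
      using chain_compression[OF z0(2) T(1,2) subspace_span zV T(3) T(3)] by auto
    then have "minimal_chain x y N (\<lambda>i. \<chi> a. T (z i $ a))"
      using z by (simp add: minimal_chain_def)
    then show ?thesis
      using T(4) by (intro exI[of _ "\<lambda>i. \<chi> a. T (z i $ a)"]) auto
  qed
  then show ?thesis
    using F by blast
qed

text \<open>Equidistant sampling; \<open>C\<close> is the Lipschitz constant times the parameter
  length and hence the same for all \<open>N\<close>.\<close>

lemma joined_chain:
  fixes x y :: "'h::real_inner ^ 'p::finite"
  assumes "joined x y"
  obtains C where "0 \<le> C"
    "\<And>N. 0 < N \<Longrightarrow> \<exists>w\<in>chains x y N. \<forall>i<N. norm (w (Suc i) - w i) \<le> C / N"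
proof -
  obtain c and T L :: real where c: "0 < T" "c 0 = x" "c T = y" "c ` {0..T} \<subseteq> frames" "L-lipschitz_on {0..T} c"
    using assms unfolding joined_def by blast
  have "\<exists>w\<in>chains x y N. \<forall>i<N. norm (w (Suc i) - w i) \<le> (L * T) / N" if N: "0 < N" for N
  proof (intro bexI[of _ "\<lambda>i :: nat. c (i * T / N)"] allI impI)
    have mem: "i * T / N \<in> {0..T}" if "i \<le> N" for i :: nat
      using c(1) N that by (auto simp: field_simps)
    then show "(\<lambda>i :: nat. c (i * T / N)) \<in> chains x y N"
      using c N by (auto simp: chains_def)
    fix i :: nat assume "i < N"
    then have "dist (c (Suc i * T / N)) (c (i * T / N)) \<le> L * dist (Suc i * T / N) (i * T / N)"
      by (intro lipschitz_onD[OF c(5)] mem) auto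
    also have "dist (Suc i * T / N) (i * T / N) = T / N"
      using c(1) by (simp add: dist_real_def distrib_right add_divide_distrib)
    finally show "norm (c (Suc i * T / N) - c (i * T / N)) \<le> (L * T) / N"
      by (simp add: dist_norm)
  qed
  moreover have "0 \<le> L * T"
    using lipschitz_on_nonneg[OF c(5)] c(1) by simp
  ultimately show ?thesis
    using that by blast
qed

lemma chain_energy_le:
  assumes "0 < N" "\<And>i. i < N \<Longrightarrow> norm (w (Suc i) - w i) \<le> C / N"
  shows "chain_energy N w \<le> C\<^sup>2 / N"
proof -
  have "chain_energy N w \<le> (\<Sum>i<N. (C / N)\<^sup>2)"
    unfolding chain_energy_def using assms by (intro sum_mono power_mono) auto
  then show ?thesis
    using assms(1) by (simp add: power2_eq_square)
qed


section \<open>Estimates for chains of low energy\<close>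

text \<open>The bound is asked only for steps between \<open>i\<close> and \<open>j\<close>, so
  \<open>\<epsilon>\<close> may depend on both. The first-order expansions below take it
  proportional to their distance.\<close>

lemma lipschitz_of_steps:
  fixes a :: "nat \<Rightarrow> 'a::real_normed_vector"
  assumes step: "\<And>k. min i j \<le> k \<Longrightarrow> k < max i j \<Longrightarrow> norm (a (Suc k) - a k) \<le> \<epsilon>"
  shows "norm (a i - a j) \<le> \<epsilon> * \<bar>real i - real j\<bar>"
proof -
  have *: "norm (a n - a m) \<le> \<epsilon> * (real n - real m)"
    if "m \<le> n" "\<And>k. m \<le> k \<Longrightarrow> k < n \<Longrightarrow> norm (a (Suc k) - a k) \<le> \<epsilon>" for m n
    using that
  proof (induction n rule: dec_induct)
    case (step n)
    have "norm (a (Suc n) - a m) \<le> norm (a (Suc n) - a n) + norm (a n - a m)"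
      using norm_triangle_ineq[of "a (Suc n) - a n" "a n - a m"] by simp
    also have "\<dots> \<le> \<epsilon> + \<epsilon> * (real n - real m)"
      using step by (intro add_mono) auto
    finally show ?case
      by (simp add: algebra_simps)
  qed simp
  show ?thesis
  proof (cases "i \<le> j")
    case True
    then show ?thesis
      using *[of i j] step by (simp add: norm_minus_commute)
  next
    case False
    then show ?thesis
      using *[of j i] step by simp
  qed
qed

text \<open>The energy bound is the one for \<open>N\<close> steps of length at most
  \<open>C / N\<close>.\<close>

locale low_energy_chain =
  fixes x y :: "'h::real_inner ^ 'p::finite" and N :: nat and z and C :: real
  assumes N_pos: "0 < N" and minimal: "minimal_chain x y N z"
    and energy: "chain_energy N z \<le> C\<^sup>2 / N" and C_nonneg: "0 \<le> C"
begin

definition \<Delta> :: "nat \<Rightarrow> 'h ^ 'p"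
  where "\<Delta> i = z (Suc i) - z i"

text \<open>The constant in \<open>norm_triple_frame\<close>; the square root is the norm of a
  frame.\<close>

definition \<kappa> :: real
  where "\<kappa> = (CARD('p))\<^sup>2 * sqrt CARD('p)"

text \<open>\<open>D / N\<close> bounds every step: some step has length at most
  \<open>C / N\<close>, and two steps differ by at most
  \<open>\<kappa> * C\<^sup>2 / N\<close>.\<close>

definition D :: real
  where "D = C + \<kappa> * C\<^sup>2"

lemma \<kappa>_nonneg: "0 \<le> \<kappa>" and D_nonneg: "0 \<le> D"
  using C_nonneg by (simp_all add: \<kappa>_def D_def)

lemma frame: "i \<le> N \<Longrightarrow> z i \<in> frames"
  using minimal by (rule minimal_chain_frames)

lemma \<Delta>_step:
  "Suc j < N \<Longrightarrow> \<Delta> (Suc j) - \<Delta> j = - (1/2) *\<^sub>R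
    (triple (z (Suc j)) (\<Delta> (Suc j)) (\<Delta> (Suc j)) + triple (z (Suc j)) (\<Delta> j) (\<Delta> j))"
  using minimal_chain_step[OF minimal] by (simp add: \<Delta>_def)

lemma norm_triple_frame: "i \<le> N \<Longrightarrow> norm (triple (z i) v v) \<le> \<kappa> * (norm v)\<^sup>2"
  using norm_triple_le[of "z i" v v] frames_norm[OF frame]
  by (simp add: \<kappa>_def power2_eq_square mult_ac)

lemma norm_\<Delta>_step_le:
  assumes "Suc j < N"
  shows "norm (\<Delta> (Suc j) - \<Delta> j) \<le> \<kappa> / 2 * (norm (\<Delta> j))\<^sup>2 + \<kappa> / 2 * (norm (\<Delta> (Suc j)))\<^sup>2"
proof -
  have "norm (\<Delta> (Suc j) - \<Delta> j) \<le>
      (norm (triple (z (Suc j)) (\<Delta> (Suc j)) (\<Delta> (Suc j))) + norm (triple (z (Suc j)) (\<Delta> j) (\<Delta> j))) / 2"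
    unfolding \<Delta>_step[OF assms] norm_scaleR by (simp add: norm_triangle_ineq)
  also have "\<dots> \<le> (\<kappa> * (norm (\<Delta> (Suc j)))\<^sup>2 + \<kappa> * (norm (\<Delta> j))\<^sup>2) / 2"
    using assms by (intro divide_right_mono add_mono norm_triple_frame) auto
  finally show ?thesis
    by (simp add: field_simps)
qed

text \<open>Second differences are quadratic in the steps, so their sum over any range is bounded by
  the energy.\<close>

lemma norm_\<Delta>_diff_le:
  assumes "j \<le> i" "i < N"
  shows "norm (\<Delta> i - \<Delta> j) \<le> \<kappa> * C\<^sup>2 / N"
proof -
  have "norm (\<Delta> i - \<Delta> j) \<le> \<kappa> / 2 * (\<Sum>k=j..<i. (norm (\<Delta> k))\<^sup>2) + \<kappa> / 2 * (\<Sum>k=j..<i. (norm (\<Delta> (Suc k)))\<^sup>2)"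
    using assms
  proof (induction i rule: dec_induct)
    case (step i)
    have "norm (\<Delta> (Suc i) - \<Delta> j) \<le> norm (\<Delta> (Suc i) - \<Delta> i) + norm (\<Delta> i - \<Delta> j)"
      using norm_triangle_ineq[of "\<Delta> (Suc i) - \<Delta> i" "\<Delta> i - \<Delta> j"] by simp
    then show ?case
      using step norm_\<Delta>_step_le[of i] by (simp add: algebra_simps)
  qed simp
  also have "(\<Sum>k=j..<i. (norm (\<Delta> k))\<^sup>2) \<le> chain_energy N z"
    unfolding chain_energy_def \<Delta>_def[symmetric] using assms by (intro sum_mono2) auto
  also have "(\<Sum>k=j..<i. (norm (\<Delta> (Suc k)))\<^sup>2) = (\<Sum>k=Suc j..<Suc i. (norm (\<Delta> k))\<^sup>2)"
    by (rule sum.shift_bounds_Suc_ivl[symmetric])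
  also have "\<dots> \<le> chain_energy N z"
    unfolding chain_energy_def \<Delta>_def[symmetric] using assms by (intro sum_mono2) auto
  finally have "norm (\<Delta> i - \<Delta> j) \<le> \<kappa> * chain_energy N z"
    using \<kappa>_nonneg by (simp add: mult_left_mono)
  also have "\<dots> \<le> \<kappa> * (C\<^sup>2 / N)"
    using energy \<kappa>_nonneg by (intro mult_left_mono)
  finally show ?thesis
    by simp
qed

text \<open>Otherwise all \<open>N\<close> squared steps would exceed
  \<open>(C / N)\<^sup>2\<close>, and the energy would exceed \<open>C\<^sup>2 / N\<close>.\<close>

lemma small_step_exists: "\<exists>j<N. norm (\<Delta> j) \<le> C / N"
proof (rule ccontr)
  assume "\<not> (\<exists>j<N. norm (\<Delta> j) \<le> C / N)"
  then have "(C / N)\<^sup>2 < (norm (\<Delta> j))\<^sup>2" if "j < N" for j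
    using that C_nonneg by (intro power_strict_mono) auto
  then have "(\<Sum>j<N. (C / N)\<^sup>2) < (\<Sum>j<N. (norm (\<Delta> j))\<^sup>2)"
    using N_pos by (intro sum_strict_mono) auto
  then show False
    using energy N_pos by (simp add: chain_energy_def \<Delta>_def power2_eq_square)
qed

lemma norm_\<Delta>_le:
  assumes "i < N"
  shows "norm (\<Delta> i) \<le> D / N"
proof -
  obtain j where j: "j < N" "norm (\<Delta> j) \<le> C / N"
    using small_step_exists by blast
  have "norm (\<Delta> i - \<Delta> j) \<le> \<kappa> * C\<^sup>2 / N"
    using norm_\<Delta>_diff_le[of j i] norm_\<Delta>_diff_le[of i j] assms j(1)
    by (cases "j \<le> i") (auto simp: norm_minus_commute)
  then show ?thesis
    using j(2) norm_triangle_sub[of "\<Delta> i" "\<Delta> j"] by (simp add: D_def add_divide_distrib)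
qed

lemma norm_\<Delta>_step:
  assumes "Suc j < N"
  shows "norm (\<Delta> (Suc j) - \<Delta> j) \<le> \<kappa> * D\<^sup>2 / (real N)\<^sup>2"
proof -
  have "(norm (\<Delta> k))\<^sup>2 \<le> (D / N)\<^sup>2" if "k < N" for k
    using norm_\<Delta>_le[OF that] by (intro power_mono) auto
  then have "\<kappa> / 2 * (norm (\<Delta> j))\<^sup>2 + \<kappa> / 2 * (norm (\<Delta> (Suc j)))\<^sup>2 \<le> \<kappa> / 2 * (D / N)\<^sup>2 + \<kappa> / 2 * (D / N)\<^sup>2"
    using assms \<kappa>_nonneg by (intro add_mono mult_left_mono) auto
  then show ?thesis
    using norm_\<Delta>_step_le[OF assms] by (simp add: power_divide)
qed

text \<open>The velocity of the chain when vertex \<open>i\<close> is placed at time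
  \<open>i / N\<close>.\<close>

definition V :: "nat \<Rightarrow> 'h ^ 'p"
  where "V i = real N *\<^sub>R \<Delta> i"

lemma \<Delta>_V: "\<Delta> i = (1 / N) *\<^sub>R V i"
  using N_pos by (simp add: V_def)

lemma norm_V_le: "i < N \<Longrightarrow> norm (V i) \<le> D"
  using norm_\<Delta>_le[of i] N_pos by (simp add: V_def field_simps)

lemma V_lipschitz:
  assumes "i < N" "j < N"
  shows "norm (V i - V j) \<le> \<kappa> * D\<^sup>2 * (\<bar>real i - real j\<bar> / N)"
proof -
  have "norm (\<Delta> i - \<Delta> j) \<le> \<kappa> * D\<^sup>2 / (real N)\<^sup>2 * \<bar>real i - real j\<bar>"
    using assms by (intro lipschitz_of_steps norm_\<Delta>_step) auto
  then have "N * norm (\<Delta> i - \<Delta> j) \<le> N * (\<kappa> * D\<^sup>2 / (real N)\<^sup>2 * \<bar>real i - real j\<bar>)"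
    by (rule mult_left_mono) simp
  moreover have "norm (V i - V j) = N * norm (\<Delta> i - \<Delta> j)"
    by (simp add: V_def flip: scaleR_diff_right)
  ultimately show ?thesis
    using N_pos by (simp add: power2_eq_square)
qed

lemma z_lipschitz:
  assumes "i \<le> N" "j \<le> N"
  shows "norm (z i - z j) \<le> D * (\<bar>real i - real j\<bar> / N)"
proof -
  have "norm (z i - z j) \<le> D / N * \<bar>real i - real j\<bar>"
    using norm_\<Delta>_le assms by (intro lipschitz_of_steps) (auto simp: \<Delta>_def)
  then show ?thesis
    by simp
qed

text \<open>After subtracting the linear motion with velocity \<open>V j\<close>, the steps are
  \<open>(V k - V j) / N\<close>, which \<open>V_lipschitz\<close> bounds by a multiple of the
  distance of \<open>i\<close> and \<open>j\<close>.\<close>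

lemma z_first_order:
  assumes "i < N" "j < N"
  shows "norm (z i - z j - ((real i - real j) / N) *\<^sub>R V j) \<le> \<kappa> * D\<^sup>2 * ((real i - real j) / N)\<^sup>2"
proof -
  define h where "h = \<bar>real i - real j\<bar> / N"
  have "norm ((z i - (i / N) *\<^sub>R V j) - (z j - (j / N) *\<^sub>R V j)) \<le> \<kappa> * D\<^sup>2 * h / N * \<bar>real i - real j\<bar>"
  proof (rule lipschitz_of_steps)
    fix k assume k: "min i j \<le> k" "k < max i j"
    have "(z (Suc k) - (Suc k / N) *\<^sub>R V j) - (z k - (k / N) *\<^sub>R V j) = \<Delta> k - (1 / N) *\<^sub>R V j"
      by (simp add: \<Delta>_def algebra_simps add_divide_distrib)
    also have "\<dots> = (1 / N) *\<^sub>R (V k - V j)"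
      by (simp add: \<Delta>_V scaleR_diff_right)
    finally have "norm ((z (Suc k) - (Suc k / N) *\<^sub>R V j) - (z k - (k / N) *\<^sub>R V j)) = norm (V k - V j) / N"
      by simp
    also have "\<dots> \<le> \<kappa> * D\<^sup>2 * (\<bar>real k - real j\<bar> / N) / N"
      using assms k by (intro divide_right_mono V_lipschitz) auto
    also have "\<dots> \<le> \<kappa> * D\<^sup>2 * h / N"
      unfolding h_def using k \<kappa>_nonneg by (intro divide_right_mono mult_left_mono) auto
    finally show "norm ((z (Suc k) - (Suc k / N) *\<^sub>R V j) - (z k - (k / N) *\<^sub>R V j)) \<le> \<kappa> * D\<^sup>2 * h / N" .
  qed
  also have "\<kappa> * D\<^sup>2 * h / N * \<bar>real i - real j\<bar> = \<kappa> * D\<^sup>2 * ((real i - real j) / N)\<^sup>2"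
    by (simp add: h_def power_divide power2_eq_square flip: abs_mult)
  finally show ?thesis
    by (simp add: algebra_simps diff_divide_distrib)
qed

text \<open>The Lipschitz constant of \<open>triple (z i) (V i) (V i)\<close> in time:
  \<open>norm_triple_diff_le\<close> with \<open>D\<close> bounding the velocities, \<open>D\<close>
  as Lipschitz constant of the vertices and \<open>\<kappa> * D\<^sup>2\<close> as that of the
  velocities.\<close>

definition M :: real
  where "M = (CARD('p))\<^sup>2 * (D\<^sup>2 * D + 2 * sqrt CARD('p) * D * (\<kappa> * D\<^sup>2))"

lemma triple_lipschitz:
  assumes "k < N" "j < N" "l < N" "\<bar>real k - real j\<bar> \<le> r" "\<bar>real l - real j\<bar> \<le> r"
  shows "norm (triple (z l) (V k) (V k) - triple (z j) (V j) (V j)) \<le> M * (r / N)"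
proof -
  have "norm (triple (z l) (V k) (V k) - triple (z j) (V j) (V j)) \<le> (CARD('p))\<^sup>2 *
      (D\<^sup>2 * norm (z l - z j) + 2 * sqrt CARD('p) * D * norm (V k - V j))"
    using assms frames_norm[OF frame, of j] norm_V_le by (intro norm_triple_diff_le) auto
  also have "\<dots> \<le> (CARD('p))\<^sup>2 *
      (D\<^sup>2 * (D * (r / N)) + 2 * sqrt CARD('p) * D * (\<kappa> * D\<^sup>2 * (r / N)))"
  proof -
    have "norm (z l - z j) \<le> D * (r / N)"
      using assms D_nonneg by (intro order_trans[OF z_lipschitz] mult_left_mono divide_right_mono) auto
    moreover have "norm (V k - V j) \<le> \<kappa> * D\<^sup>2 * (r / N)"
      using assms \<kappa>_nonneg by (intro order_trans[OF V_lipschitz] mult_left_mono divide_right_mono) auto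
    ultimately show ?thesis
      using D_nonneg by (intro mult_left_mono add_mono) auto
  qed
  finally show ?thesis
    by (simp add: M_def algebra_simps)
qed

text \<open>The discrete form of \<open>V' = - triple z V V\<close>. After adding the linear motion
  with velocity \<open>Q\<close>, each step is an average of two differences between nearby values
  of \<open>triple\<close> and \<open>Q\<close>.\<close>

lemma V_first_order:
  assumes "i < N" "j < N"
  shows "norm (V i - V j + ((real i - real j) / N) *\<^sub>R triple (z j) (V j) (V j)) \<le>
    M * ((real i - real j) / N)\<^sup>2"
proof -
  define r where "r = \<bar>real i - real j\<bar>"
  define Q where "Q = triple (z j) (V j) (V j)"
  have "norm ((V i + (i / N) *\<^sub>R Q) - (V j + (j / N) *\<^sub>R Q)) \<le> M * (r / N) / N * \<bar>real i - real j\<bar>"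
  proof (rule lipschitz_of_steps)
    fix k assume k: "min i j \<le> k" "k < max i j"
    let ?A = "triple (z (Suc k)) (V (Suc k)) (V (Suc k))" and ?B = "triple (z (Suc k)) (V k) (V k)"
    have kN: "Suc k < N"
      using k assms by auto
    \<comment> \<open>Both occurrences of \<Delta> in \<open>triple\<close> give a factor
      \<open>1 / N\<close>, and one of the two factors cancels against \<open>N\<close>.\<close>
    have "V (Suc k) - V k = real N *\<^sub>R (\<Delta> (Suc k) - \<Delta> k)"
      by (simp add: V_def scaleR_diff_right)
    also have "\<dots> = - (1 / (2 * N)) *\<^sub>R (?A + ?B)"
      using N_pos unfolding \<Delta>_step[OF kN] unfolding \<Delta>_V triple_simps by (simp add: algebra_simps)
    finally have dV: "V (Suc k) - V k = - (1 / (2 * N)) *\<^sub>R (?A + ?B)" .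
    have "(V (Suc k) + (Suc k / N) *\<^sub>R Q) - (V k + (k / N) *\<^sub>R Q) = (V (Suc k) - V k) + (1 / N) *\<^sub>R Q"
      by (simp add: algebra_simps add_divide_distrib)
    also have "(1 / N) *\<^sub>R Q = (1 / (2 * N)) *\<^sub>R (Q + Q)"
      by (simp flip: scaleR_2)
    finally have "(V (Suc k) + (Suc k / N) *\<^sub>R Q) - (V k + (k / N) *\<^sub>R Q) =
        - (1 / (2 * N)) *\<^sub>R ((?A - Q) + (?B - Q))"
      unfolding dV by (simp add: algebra_simps)
    then have "norm ((V (Suc k) + (Suc k / N) *\<^sub>R Q) - (V k + (k / N) *\<^sub>R Q)) =
        norm ((?A - Q) + (?B - Q)) / (2 * N)"
      by (simp only: norm_scaleR) simp
    also have "\<dots> \<le> (norm (?A - Q) + norm (?B - Q)) / (2 * N)"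
      by (intro divide_right_mono norm_triangle_ineq) simp
    also have "\<dots> \<le> (M * (r / N) + M * (r / N)) / (2 * N)"
      unfolding Q_def using k kN assms
      by (intro divide_right_mono add_mono triple_lipschitz) (auto simp: r_def)
    finally show "norm ((V (Suc k) + (Suc k / N) *\<^sub>R Q) - (V k + (k / N) *\<^sub>R Q)) \<le> M * (r / N) / N"
      by (simp add: mult.commute)
  qed
  also have "M * (r / N) / N * \<bar>real i - real j\<bar> = M * ((real i - real j) / N)\<^sup>2"
    by (simp add: r_def power_divide power2_eq_square flip: abs_mult)
  finally show ?thesis
    by (simp add: Q_def algebra_simps diff_divide_distrib)
qed

text \<open>The speed is conserved one order better than the velocity, since the second difference is
  normal and chords are almost tangential.\<close>

lemma speed_step:
  assumes j: "Suc j < N"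
  shows "\<bar>(norm (\<Delta> (Suc j)))\<^sup>2 - (norm (\<Delta> j))\<^sup>2\<bar> \<le> (CARD('p))\<^sup>2 * (D / N) ^ 4"
proof -
  let ?x = "z (Suc j)" and ?c = "(CARD('p))\<^sup>2 :: real"
  let ?A = "triple ?x (\<Delta> (Suc j)) (\<Delta> (Suc j))" and ?B = "triple ?x (\<Delta> j) (\<Delta> j)"
  have small: "\<bar>triple ?x (\<Delta> k) (\<Delta> k) \<bullet> (z i - ?x)\<bar> \<le> ?c * (D / N) ^ 4 / 2"
    if "k < N" "i \<le> N" "norm (z i - ?x) \<le> D / N" for k i
  proof -
    have "\<bar>triple ?x (\<Delta> k) (\<Delta> k) \<bullet> (z i - ?x)\<bar> \<le> ?c * (norm (\<Delta> k))\<^sup>2 * (norm (z i - ?x))\<^sup>2 / 2"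
      using that j by (intro triple_chord_small frame) auto
    also have "\<dots> \<le> ?c * (D / N)\<^sup>2 * (D / N)\<^sup>2 / 2"
      using that norm_\<Delta>_le[of k]
      by (intro divide_right_mono mult_mono power_mono) auto
    finally show ?thesis
      by (simp add: power4_eq_xxxx power2_eq_square mult_ac)
  qed
  have near: "norm (z (Suc (Suc j)) - ?x) \<le> D / N" "norm (z j - ?x) \<le> D / N"
    using norm_\<Delta>_le[of "Suc j"] norm_\<Delta>_le[of j] j by (auto simp: \<Delta>_def norm_minus_commute)
  have "(norm (\<Delta> (Suc j)))\<^sup>2 - (norm (\<Delta> j))\<^sup>2 = (\<Delta> (Suc j) - \<Delta> j) \<bullet> (\<Delta> (Suc j) + \<Delta> j)"
    by (simp add: power2_norm_eq_inner inner_simps inner_commute)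
  \<comment> \<open>Written as a difference of two chords issuing from \<open>?x\<close>, so that
    each resulting term is covered by \<open>small\<close>.\<close>
  also have "\<Delta> (Suc j) + \<Delta> j = (z (Suc (Suc j)) - ?x) - (z j - ?x)"
    by (simp add: \<Delta>_def)
  also have "(\<Delta> (Suc j) - \<Delta> j) \<bullet> \<dots> = - (1/2) *
      (?A \<bullet> (z (Suc (Suc j)) - ?x) + ?B \<bullet> (z (Suc (Suc j)) - ?x) - ?A \<bullet> (z j - ?x) - ?B \<bullet> (z j - ?x))"
    unfolding \<Delta>_step[OF j] by (simp add: inner_diff_right inner_add_left) (simp add: field_simps)
  finally show ?thesis
    using small[OF _ _ near(1), of "Suc j"] small[OF _ _ near(1), of j]
      small[OF _ _ near(2), of "Suc j"] small[OF _ _ near(2), of j] j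
    by (simp add: abs_le_iff) linarith
qed

text \<open>At most \<open>N\<close> steps each contribute an error of order \<open>N^(-4)\<close>;
  rescaling by \<open>N\<^sup>2\<close> leaves order \<open>1 / N\<close>.\<close>

lemma speed_almost_constant:
  assumes "i < N" "j < N"
  shows "\<bar>(norm (V i))\<^sup>2 - (norm (V j))\<^sup>2\<bar> \<le> (CARD('p))\<^sup>2 * D ^ 4 / N"
proof -
  let ?c = "(CARD('p))\<^sup>2 :: real"
  have "norm ((norm (\<Delta> i))\<^sup>2 - (norm (\<Delta> j))\<^sup>2) \<le> (?c * (D / N) ^ 4) * \<bar>real i - real j\<bar>"
    using assms speed_step by (intro lipschitz_of_steps) auto
  also have "\<dots> \<le> (?c * (D / N) ^ 4) * N"
    using assms D_nonneg by (intro mult_left_mono) auto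
  finally have "(real N)\<^sup>2 * \<bar>(norm (\<Delta> i))\<^sup>2 - (norm (\<Delta> j))\<^sup>2\<bar> \<le> (real N)\<^sup>2 * ((?c * (D / N) ^ 4) * N)"
    by (intro mult_left_mono) auto
  moreover have "\<bar>(norm (V i))\<^sup>2 - (norm (V j))\<^sup>2\<bar> = (real N)\<^sup>2 * \<bar>(norm (\<Delta> i))\<^sup>2 - (norm (\<Delta> j))\<^sup>2\<bar>"
    by (simp add: V_def power_mult_distrib abs_mult flip: right_diff_distrib)
  moreover have "(real N)\<^sup>2 * ((?c * (D / N) ^ 4) * N) = ?c * D ^ 4 / N"
    using N_pos by (simp add: power_divide power4_eq_xxxx power2_eq_square field_simps)
  ultimately show ?thesis
    by simp
qed

text \<open>Some step obeys the bound \<open>L / N\<close> from the better energy estimate, and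
  almost constant speed carries it to all steps, up to an error vanishing as \<open>N\<close>
  grows.\<close>

lemma speed_le:
  assumes "i < N" and L: "0 \<le> L" "chain_energy N z \<le> L\<^sup>2 / N"
  shows "(norm (V i))\<^sup>2 \<le> L\<^sup>2 + (CARD('p))\<^sup>2 * D ^ 4 / N"
proof -
  \<comment> \<open>The same chain with \<open>L\<close> for \<open>C\<close> supplies the short
    step; the \<open>D\<close> in the error term remains the one belonging to
    \<open>C\<close>.\<close>
  interpret L: low_energy_chain x y N z L
    using N_pos minimal L by unfold_locales
  obtain j where j: "j < N" "norm (\<Delta> j) \<le> L / N"
    using L.small_step_exists by (auto simp: \<Delta>_def L.\<Delta>_def)
  then have "norm (V j) \<le> L"
    using N_pos by (simp add: V_def field_simps)
  then have "(norm (V j))\<^sup>2 \<le> L\<^sup>2"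
    by (intro power_mono) auto
  then show ?thesis
    using speed_almost_constant[OF assms(1) j(1)] by linarith
qed

end


section \<open>The limit of minimal chains\<close>

lemma tendsto_triple [tendsto_intros]:
  assumes "(f \<longlongrightarrow> x) G" "(g \<longlongrightarrow> u) G" "(h \<longlongrightarrow> v) G"
  shows "((\<lambda>n. triple (f n) (g n) (h n)) \<longlongrightarrow> triple x u v) G"
  unfolding triple_def using assms by (intro tendsto_intros)

section \<open>Derivatives from discrete expansions, cluster points and grids\<close>

lemma has_vector_derivative_of_quadratic_bound:
  fixes f :: "real \<Rightarrow> 'a::real_normed_vector"
  assumes "\<And>t. t \<in> S \<Longrightarrow> norm (f t - f s - (t - s) *\<^sub>R d) \<le> K * (t - s)\<^sup>2"
  shows "(f has_vector_derivative d) (at s within S)"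
  unfolding has_vector_derivative_def
proof (rule has_derivativeI_sandwich[of 1])
  show "bounded_linear (\<lambda>x. x *\<^sub>R d)"
    by (rule bounded_linear_scaleR_left)
  show "((\<lambda>t. K * \<bar>t - s\<bar>) \<longlongrightarrow> 0) (at s within S)"
    by (auto intro!: tendsto_eq_intros)
  fix t assume "t \<in> S" "t \<noteq> s"
  then show "norm (f t - f s - (t - s) *\<^sub>R d) / norm (t - s) \<le> K * \<bar>t - s\<bar>"
    using assms[of t] by (simp add: divide_le_eq power2_eq_square mult.assoc flip: abs_mult)
qed simp

text \<open>A filter \<open>G\<close> finer than \<open>sequentially\<close> replaces a subsequence:
  a compact product over uncountably many indices need not be sequentially compact.\<close>

lemma compact_sequence_cluster:
  fixes f :: "nat \<Rightarrow> 'a::topological_space"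
  assumes "compact K" "\<And>n. f n \<in> K"
  obtains g G where "g \<in> K" "G \<noteq> bot" "G \<le> sequentially" "(f \<longlongrightarrow> g) G"
proof -
  have "filtermap f sequentially \<noteq> bot"
    by (simp add: filtermap_bot_iff)
  moreover have "eventually (\<lambda>h. h \<in> K) (filtermap f sequentially)"
    by (simp add: eventually_filtermap assms(2))
  ultimately obtain g where g: "g \<in> K" "inf (nhds g) (filtermap f sequentially) \<noteq> bot"
    using assms(1) unfolding compact_filter by blast
  \<comment> \<open>\<open>G\<close> consists of late indices whose values are near
    \<open>g\<close>; it is proper because \<open>g\<close> is a cluster point.\<close>
  define G where "G = inf (filtercomap f (nhds g)) sequentially"
  have "G \<noteq> bot"
  proof
    assume "G = bot"
    then have "eventually (\<lambda>_. False) G"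
      by simp
    then obtain P Q where PQ: "eventually P (filtercomap f (nhds g))" "eventually Q sequentially"
      "\<And>n. P n \<Longrightarrow> Q n \<Longrightarrow> False"
      unfolding G_def eventually_inf by blast
    obtain R where R: "eventually R (nhds g)" "\<And>n. R (f n) \<Longrightarrow> P n"
      using PQ(1) by (auto simp: eventually_filtercomap)
    have "eventually (\<lambda>h. \<not> R h) (filtermap f sequentially)"
      unfolding eventually_filtermap using PQ(2) by eventually_elim (use PQ(3) R(2) in blast)
    then have "eventually (\<lambda>_. False) (inf (nhds g) (filtermap f sequentially))"
      unfolding eventually_inf using R(1) by blast
    then show False
      using g(2) by (simp add: trivial_limit_def)
  qed
  moreover have "(f \<longlongrightarrow> g) G"
    unfolding G_def by (rule filterlim_mono[OF filterlim_filtercomap]) auto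
  ultimately show ?thesis
    using that[of g G] g(1) by (simp add: G_def)
qed

lemma tendsto_apply_function:
  fixes f :: "'n \<Rightarrow> 'i \<Rightarrow> 'a::topological_space"
  assumes "(f \<longlongrightarrow> g) G"
  shows "((\<lambda>n. f n i) \<longlongrightarrow> g i) G"
  using continuous_on_tendsto_compose[OF continuous_on_product_coordinates assms] by simp

text \<open>Meant for chains with \<open>Suc n\<close> steps: the index never exceeds
  \<open>n\<close>, so a step starts at every index used.\<close>

definition grid_index :: "nat \<Rightarrow> real \<Rightarrow> nat"
  where "grid_index n t = min n (nat \<lfloor>real n * t\<rfloor>)"

lemma grid_index_tendsto:
  assumes "t \<in> {0..1}"
  shows "(\<lambda>n. real (grid_index n t) / Suc n) \<longlonglongrightarrow> t"
proof -
  \<comment> \<open>Rounding down costs at most 1 in the numerator, and passing from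
    \<open>n\<close> to \<open>Suc n\<close> costs \<open>t\<close>, again at most 1.\<close>
  have "norm (real (grid_index n t) / Suc n - t) \<le> 2 / Suc n" for n
  proof -
    have "0 \<le> real n * t" "real n * t \<le> n"
      using assms by (auto simp: mult_left_le)
    then have "grid_index n t = nat \<lfloor>real n * t\<rfloor>"
      unfolding grid_index_def by linarith
    then have "\<bar>real (grid_index n t) - real n * t\<bar> \<le> 1"
      using \<open>0 \<le> real n * t\<close> by linarith
    moreover have "real (grid_index n t) / Suc n - t = (real (grid_index n t) - real n * t - t) / Suc n"
      by (simp add: field_simps)
    moreover have "\<bar>real (grid_index n t) - real n * t - t\<bar> \<le> 2"
      using \<open>\<bar>real (grid_index n t) - real n * t\<bar> \<le> 1\<close> assms by (simp add: abs_le_iff)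
    ultimately show ?thesis
      by (simp add: abs_divide divide_right_mono)
  qed
  then have "(\<lambda>n. real (grid_index n t) / Suc n - t) \<longlonglongrightarrow> 0"
    by (intro Lim_null_comparison[OF always_eventually LIMSEQ_Suc[OF lim_const_over_n[of 2]]]) auto
  then show ?thesis
    by (rule LIM_zero_cancel)
qed

lemma grid_index_endpoints: "grid_index n 0 = 0" "grid_index n 1 = n"
  by (simp_all add: grid_index_def)

text \<open>By Tychonoff's theorem the interpolated chains have a cluster point in the product topology.
  Pointwise convergence suffices: the discrete estimates compare at most two times at once,
  and they become first-order expansions in the limit.\<close>

lemma limit_of_minimal_chains:
  fixes x y :: "'h::real_inner ^ 'p::finite"
  assumes "joined x y"
  shows "\<exists>X V v. X 0 = x \<and> X 1 = y \<and>
    (\<forall>t\<in>{0..1}. X t \<in> frames \<and> norm (V t) = v \<and>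
      (X has_vector_derivative V t) (at t within {0..1}) \<and>
      (V has_vector_derivative - triple (X t) (V t) (V t)) (at t within {0..1})) \<and>
    (\<forall>L\<ge>0. (\<forall>N>0. \<exists>w\<in>chains x y N. \<forall>i<N. norm (w (Suc i) - w i) \<le> L / N) \<longrightarrow> v \<le> L)"
proof -
  obtain C where C: "0 \<le> C"
    "\<And>N. 0 < N \<Longrightarrow> \<exists>w\<in>chains x y N. \<forall>i<N. norm (w (Suc i) - w i) \<le> C / N"
    using joined_chain[OF assms] by blast
  obtain F where F: "finite F"
    "\<And>N. 0 < N \<Longrightarrow> \<exists>z. minimal_chain x y N z \<and> (\<forall>i\<le>N. \<forall>a. z i $ a \<in> span F)"
    using minimal_chains_in_fixed_span[of x y] C(2) by blast
  obtain z where z: "\<And>n. minimal_chain x y (Suc n) (z n)"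
      "\<And>n i a. i \<le> Suc n \<Longrightarrow> z n i $ a \<in> span F"
    using F(2)[OF zero_less_Suc] by metis
  \<comment> \<open>A chain with steps of length at most \<open>L / N\<close> competes with the
    minimal one. This serves first for \<open>C\<close> and later for the lengths of arbitrary
    competing paths.\<close>
  have energy: "chain_energy (Suc n) (z n) \<le> L\<^sup>2 / Suc n"
    if "\<And>N. 0 < N \<Longrightarrow> \<exists>w\<in>chains x y N. \<forall>i<N. norm (w (Suc i) - w i) \<le> L / N" for L n
  proof -
    obtain w where "w \<in> chains x y (Suc n)" "\<forall>i<Suc n. norm (w (Suc i) - w i) \<le> L / Suc n"
      using \<open>\<And>N. 0 < N \<Longrightarrow> \<exists>w\<in>chains x y N. \<forall>i<N. norm (w (Suc i) - w i) \<le> L / N\<close>[of "Suc n"] by auto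
    then show ?thesis
      using z(1)[of n] chain_energy_le[of "Suc n" w L] unfolding minimal_chain_def by fastforce
  qed
  interpret L: low_energy_chain x y "Suc n" "z n" C for n
    using z(1) energy[OF C(2)] C(1) by unfold_locales auto
  define k where "k = grid_index"
  have k: "k n t \<le> n" "k n t < Suc n" for n t
    by (simp_all add: k_def grid_index_def less_Suc_eq_le)
  obtain K1 where K1: "compact K1" "\<And>w :: 'h ^ 'p. (\<And>a. w $ a \<in> span F) \<Longrightarrow> norm w \<le> sqrt CARD('p) \<Longrightarrow> w \<in> K1"
    using compact_columns_in_span[OF F(1), of "sqrt CARD('p)"] by blast
  \<comment> \<open>\<open>L.D\<close> is independent of \<open>n\<close>, so one compact set
    contains the velocities of all chains.\<close>
  obtain K2 where K2: "compact K2" "\<And>w :: 'h ^ 'p. (\<And>a. w $ a \<in> span F) \<Longrightarrow> norm w \<le> L.D \<Longrightarrow> w \<in> K2"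
    using compact_columns_in_span[OF F(1), of L.D] by blast
  define f where "f n t = (z n (k n t), L.V n (k n t))" for n t
  have "f n t \<in> K1 \<times> K2" for n t
  proof -
    have "z n (k n t) \<in> K1"
      using z(2) frames_norm[OF L.frame, of "k n t" n] k by (intro K1(2)) (auto simp: le_SucI)
    moreover have "L.V n (k n t) \<in> K2"
      using z(2) k L.norm_V_le by (intro K2(2)) (auto simp: L.V_def L.\<Delta>_def le_SucI intro!: span_scale span_diff)
    ultimately show ?thesis
      by (simp add: f_def)
  qed
  moreover have "compact {h :: real \<Rightarrow> ('h ^ 'p) \<times> ('h ^ 'p). \<forall>t. h t \<in> K1 \<times> K2}"
    by (intro compact_PiE_UNIV compact_Times K1 K2)
  ultimately obtain g G where G: "G \<noteq> bot" "G \<le> sequentially" "(f \<longlongrightarrow> g) G"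
    by (auto elim: compact_sequence_cluster[of _ f])
  define X V where "X t = fst (g t)" and "V t = snd (g t)" for t
  have X: "((\<lambda>n. z n (k n t)) \<longlongrightarrow> X t) G" and V: "((\<lambda>n. L.V n (k n t)) \<longlongrightarrow> V t) G" for t
    using tendsto_fst[OF tendsto_apply_function[OF G(3), of t]]
      tendsto_snd[OF tendsto_apply_function[OF G(3), of t]]
    by (simp_all add: f_def X_def V_def)
  have h: "((\<lambda>n. (real (k n t) - real (k n s)) / Suc n) \<longlongrightarrow> t - s) G" if "s \<in> {0..1}" "t \<in> {0..1}" for s t
    unfolding diff_divide_distrib k_def
    using that by (intro tendsto_diff tendsto_mono[OF G(2)] grid_index_tendsto)
  have null: "((\<lambda>n. c / real (Suc n)) \<longlongrightarrow> 0) G" for c :: real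
    by (rule tendsto_mono[OF G(2) LIMSEQ_Suc[OF lim_const_over_n]])
  have frames: "X t \<in> frames" for t
    using closed_frames G(1) X[of t] k L.frame
    by (intro Lim_in_closed_set[of frames]) (auto intro!: always_eventually simp: le_SucI)
  have dX: "(X has_vector_derivative V s) (at s within {0..1})" if s: "s \<in> {0..1}" for s
  proof (rule has_vector_derivative_of_quadratic_bound)
    fix t :: real assume "t \<in> {0..1}"
    then have "((\<lambda>n. norm (z n (k n t) - z n (k n s) - ((real (k n t) - real (k n s)) / Suc n) *\<^sub>R L.V n (k n s)))
        \<longlongrightarrow> norm (X t - X s - (t - s) *\<^sub>R V s)) G"
      "((\<lambda>n. L.\<kappa> * L.D\<^sup>2 * ((real (k n t) - real (k n s)) / Suc n)\<^sup>2) \<longlongrightarrow> L.\<kappa> * L.D\<^sup>2 * (t - s)\<^sup>2) G"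
      using s by (intro tendsto_intros X V h; simp)+
    then show "norm (X t - X s - (t - s) *\<^sub>R V s) \<le> L.\<kappa> * L.D\<^sup>2 * (t - s)\<^sup>2"
      using L.z_first_order[OF k(2) k(2)] by (intro tendsto_le[OF G(1)]) (auto intro!: always_eventually)
  qed
  have dV: "(V has_vector_derivative - triple (X s) (V s) (V s)) (at s within {0..1})" if s: "s \<in> {0..1}" for s
  proof (rule has_vector_derivative_of_quadratic_bound)
    fix t :: real assume "t \<in> {0..1}"
    then have "((\<lambda>n. norm (L.V n (k n t) - L.V n (k n s) + ((real (k n t) - real (k n s)) / Suc n) *\<^sub>R
        triple (z n (k n s)) (L.V n (k n s)) (L.V n (k n s))))
        \<longlongrightarrow> norm (V t - V s + (t - s) *\<^sub>R triple (X s) (V s) (V s))) G"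
      "((\<lambda>n. L.M * ((real (k n t) - real (k n s)) / Suc n)\<^sup>2) \<longlongrightarrow> L.M * (t - s)\<^sup>2) G"
      using s by (intro tendsto_intros X V h; simp)+
    then have "norm (V t - V s + (t - s) *\<^sub>R triple (X s) (V s) (V s)) \<le> L.M * (t - s)\<^sup>2"
      using L.V_first_order[OF k(2) k(2)] by (intro tendsto_le[OF G(1)]) (auto intro!: always_eventually)
    then show "norm (V t - V s - (t - s) *\<^sub>R - triple (X s) (V s) (V s)) \<le> L.M * (t - s)\<^sup>2"
      by simp
  qed
  have "X 0 = x"
  proof -
    have "z n (k n 0) = x" for n
      using z(1)[of n] by (simp add: k_def grid_index_endpoints minimal_chain_def chains_def)
    then show ?thesis
      using X[of 0] G(1) by (simp add: tendsto_const_iff)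
  qed
  moreover have "X 1 = y"
  proof -
    \<comment> \<open>At time 1 the index is \<open>n\<close>, one step short of the final vertex
      \<open>y\<close>; the gap vanishes in the limit.\<close>
    have "norm (z n (k n 1) - y) \<le> L.D / Suc n" for n
    proof -
      have "y = z n (Suc n)"
        using z(1)[of n] by (simp add: minimal_chain_def chains_def)
      then show ?thesis
        using L.z_lipschitz[of n n "Suc n"] by (simp add: k_def grid_index_endpoints)
    qed
    then have "((\<lambda>n. z n (k n 1) - y) \<longlongrightarrow> 0) G"
      by (intro Lim_null_comparison[OF always_eventually null]) auto
    then have "((\<lambda>n. z n (k n 1)) \<longlongrightarrow> y) G"
      by (rule LIM_zero_cancel)
    then show ?thesis
      using X[of 1] G(1) tendsto_unique by blast
  qed
  moreover have "norm (V t) = norm (V 0)" for t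
  proof -
    have "((\<lambda>n. \<bar>(norm (L.V n (k n t)))\<^sup>2 - (norm (L.V n (k n 0)))\<^sup>2\<bar>) \<longlongrightarrow>
        \<bar>(norm (V t))\<^sup>2 - (norm (V 0))\<^sup>2\<bar>) G"
      by (intro tendsto_intros V)
    then have "\<bar>(norm (V t))\<^sup>2 - (norm (V 0))\<^sup>2\<bar> \<le> 0"
      using L.speed_almost_constant[OF k(2) k(2)]
      by (intro tendsto_le[OF G(1) null]) (auto intro!: always_eventually)
    then show ?thesis
      by simp
  qed
  moreover have "norm (V 0) \<le> L"
    if L: "0 \<le> L" "\<forall>N>0. \<exists>w\<in>chains x y N. \<forall>i<N. norm (w (Suc i) - w i) \<le> L / N" for L
  proof -
    have "((\<lambda>n. (norm (L.V n (k n 0)))\<^sup>2) \<longlongrightarrow> (norm (V 0))\<^sup>2) G"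
      by (intro tendsto_intros V)
    moreover have "((\<lambda>n. L\<^sup>2 + (CARD('p))\<^sup>2 * L.D ^ 4 / Suc n) \<longlongrightarrow> L\<^sup>2 + 0) G"
      by (intro tendsto_intros null)
    ultimately have "(norm (V 0))\<^sup>2 \<le> L\<^sup>2 + 0"
      using L.speed_le[OF k(2) L(1) energy] L(2)
      by (intro tendsto_le[OF G(1)]) (auto intro!: always_eventually)
    then show ?thesis
      using L(1) by (simp add: power2_le_iff_abs_le)
  qed
  ultimately show ?thesis
    using frames dX dV by (intro exI[of _ X] exI[of _ V] exI[of _ "norm (V 0)"]) auto
qed


section \<open>Lengths and smoothness of curves\<close>

text \<open>The partition times are those where the arc length \<open>l\<close> is a multiple of
  \<open>L / N\<close>, by the intermediate value theorem; chords are no longer than the arcs they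
  cut off.\<close>

lemma equal_length_partition:
  fixes c :: "real \<Rightarrow> 'a::real_inner"
  assumes cont: "continuous_on {0..1} c" and S: "finite S"
    and deriv: "\<And>t. t \<in> {0..1} - S \<Longrightarrow> (c has_vector_derivative D t) (at t)"
    and D: "continuous_on ({0..1} - S) D"
    and length: "(\<integral>\<^sup>+t\<in>{0..1}. ennreal (norm (D t)) \<partial>lborel) = ennreal L" and L: "0 \<le> L" and N: "0 < N"
  shows "\<exists>\<tau> :: nat \<Rightarrow> real. (\<forall>i\<le>N. \<tau> i \<in> {0..1}) \<and> c (\<tau> 0) = c 0 \<and> c (\<tau> N) = c 1 \<and>
    (\<forall>i<N. norm (c (\<tau> (Suc i)) - c (\<tau> i)) \<le> L / N)"
proof -
  let ?A = "{0..1} - S"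
  \<comment> \<open>The speed, set to zero off the unit interval and on the null set
    \<open>S\<close>, where \<open>D\<close> is arbitrary.\<close>
  define s where "s t = (if t \<in> ?A then norm (D t) else 0)" for t
  have s_ind: "s = (\<lambda>t. indicator ?A t *\<^sub>R norm (D t))"
    by (auto simp: s_def fun_eq_iff)
  have meas: "s \<in> borel_measurable lborel"
  proof -
    have "?A \<in> sets borel"
      using borel_closed[OF finite_imp_closed[OF S]] by (intro sets.Diff) auto
    then have "(\<lambda>t. indicator ?A t *\<^sub>R norm (D t)) \<in> borel_measurable borel"
      by (intro borel_measurable_continuous_on_indicator continuous_on_norm D)
    then show ?thesis
      unfolding s_ind by simp
  qed
  have "(\<integral>\<^sup>+t. ennreal (s t) \<partial>lborel) = (\<integral>\<^sup>+t\<in>{0..1}. ennreal (norm (D t)) \<partial>lborel)"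
  proof (rule nn_integral_cong_AE)
    have "AE t in lborel. t \<notin> S"
      using S by (intro AE_not_in finite_imp_null_set_lborel)
    then show "AE t in lborel. ennreal (s t) = ennreal (norm (D t)) * indicator {0..1} t"
      by eventually_elim (auto simp: s_def indicator_def)
  qed
  then have nn: "(\<integral>\<^sup>+t. ennreal (s t) \<partial>lborel) = ennreal L"
    using length by simp
  have "integrable lborel s \<and> integral\<^sup>L lborel s = L"
    using nn meas L by (intro nn_integral_eq_integrable[THEN iffD1]) (auto simp: s_def)
  then have int: "(s has_integral L) UNIV"
    using has_integral_integral_lborel by blast
  have intab: "s integrable_on {a..b}" for a b
    using integrable_on_subcbox[of s UNIV a b] int by (auto simp: integrable_on_def)
  have int01: "integral {0..1} s = L"
  proof -
    have "integral {0..1} s = integral UNIV (\<lambda>t. if t \<in> {0..1} then s t else 0)"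
      by (rule integral_restrict_UNIV[symmetric])
    also have "(\<lambda>t. if t \<in> {0..1} then s t else 0) = s"
      by (auto simp: s_def)
    finally show ?thesis
      using int by (simp add: integral_unique)
  qed
  define l where "l t = integral {0..t} s" for t
  have l_diff: "l v - l u = integral {u..v} s" if "0 \<le> u" "u \<le> v" for u v
    using Henstock_Kurzweil_Integration.integral_combine[OF that intab[of 0 v]] by (simp add: l_def)
  have chord: "norm (c v - c u) \<le> l v - l u" if uv: "0 \<le> u" "u \<le> v" "v \<le> 1" for u v
  proof -
    \<comment> \<open>Pair the curve with the chord itself: the fundamental theorem with finitely
      many exceptional points applies to a real function, and Cauchy-Schwarz bounds its derivative
      by \<open>s t * norm w\<close>.\<close>
    define w where "w = c v - c u"
    have "((\<lambda>t. if t \<in> ?A then D t \<bullet> w else 0) has_integral (c v \<bullet> w - c u \<bullet> w)) {u..v}"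
    proof (rule fundamental_theorem_of_calculus_interior_strong[OF S uv(2)])
      fix t assume "t \<in> {u<..<v} - S"
      then have "t \<in> ?A"
        using uv by auto
      then show "((\<lambda>t. c t \<bullet> w) has_vector_derivative (if t \<in> ?A then D t \<bullet> w else 0)) (at t)"
        using bounded_linear.has_vector_derivative[OF bounded_linear_inner_left deriv] by auto
    next
      show "continuous_on {u..v} (\<lambda>t. c t \<bullet> w)"
        using uv by (intro continuous_intros continuous_on_subset[OF cont]) auto
    qed
    moreover have "((\<lambda>t. s t * norm w) has_integral (l v - l u) * norm w) {u..v}"
      unfolding l_diff[OF uv(1,2)] by (intro has_integral_mult_left integrable_integral intab)
    ultimately have "c v \<bullet> w - c u \<bullet> w \<le> (l v - l u) * norm w"
      by (rule has_integral_le) (auto simp: s_def norm_cauchy_schwarz)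
    then have "norm w * norm w \<le> (l v - l u) * norm w"
      by (simp add: w_def inner_diff_left power2_norm_eq_inner flip: power2_eq_square)
    moreover have "0 \<le> l v - l u"
      unfolding l_diff[OF uv(1,2)] using intab by (intro integral_nonneg) (auto simp: s_def)
    ultimately show ?thesis
      by (cases "w = 0") (auto simp: w_def)
  qed
  have chord': "norm (c v - c u) \<le> \<bar>l v - l u\<bar>" if "u \<in> {0..1}" "v \<in> {0..1}" for u v
    using chord[of u v] chord[of v u] that by (cases "u \<le> v") (auto simp: norm_minus_commute)
  have "continuous_on {0..1} l"
    unfolding l_def by (intro indefinite_integral_continuous_1 intab)
  moreover have l01: "l 0 = 0" "l 1 = L"
    using int01 by (simp_all add: l_def)
  ultimately have "\<exists>t\<in>{0..1}. l t = i * L / N" if "i \<le> N" for i :: nat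
  proof -
    have "i * L / N \<le> L"
      using that L N by (simp add: divide_le_eq mult.commute[of L] mult_right_mono)
    then obtain t where "0 \<le> t" "t \<le> 1" "l t = i * L / N"
      using IVT'[of l 0 "i * L / N" 1] L l01 \<open>continuous_on {0..1} l\<close> by auto
    then show ?thesis
      by auto
  qed
  then obtain \<tau> where \<tau>: "\<And>i. i \<le> N \<Longrightarrow> \<tau> i \<in> {0..1} \<and> l (\<tau> i) = real i * L / N"
    by metis
  \<comment> \<open>If the curve rests at an end, \<open>\<tau> 0\<close> or \<open>\<tau> N\<close>
    may differ from the end point of the interval; no length lies in between, so the values of
    \<open>c\<close> agree.\<close>
  have "c (\<tau> 0) = c 0" "c (\<tau> N) = c 1"
    using chord'[of 0 "\<tau> 0"] chord'[of 1 "\<tau> N"] \<tau>[of 0] \<tau>[of N] l01 N by auto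
  moreover have "norm (c (\<tau> (Suc i)) - c (\<tau> i)) \<le> L / N" if "i < N" for i
  proof -
    have "l (\<tau> (Suc i)) - l (\<tau> i) = L / N"
      using \<tau>[of i] \<tau>[of "Suc i"] that by (simp add: distrib_right add_divide_distrib)
    then show ?thesis
      using chord'[of "\<tau> i" "\<tau> (Suc i)"] \<tau>[of i] \<tau>[of "Suc i"] that L N by simp
  qed
  ultimately show ?thesis
    using \<tau> by blast
qed

section \<open>Smoothness on the unit interval\<close>

lemma velocity_eq:
  assumes "t \<in> {0..1}" "(f has_vector_derivative d) (at t within {0..1})"
  shows "velocity f t = d"
  unfolding velocity_def using assms by (intro vector_derivative_within_cbox[of 0 1, unfolded box_real]) auto

lemma has_vector_derivative_cong_unit:
  assumes "\<And>t. t \<in> {0..1} \<Longrightarrow> f t = g t" "t \<in> {0..1}"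
    and "(f has_vector_derivative d) (at t within {0..1::real})"
  shows "(g has_vector_derivative d) (at t within {0..1})"
  using has_vector_derivative_transform[of t "{0..1}" g f d] assms by auto

text \<open>Iterated differentiability with an arbitrary witness for the derivative at each level in
  place of \<open>velocity\<close>, which gives closure under sums, linear and bilinear maps by
  induction.\<close>

primrec smooth_upto :: "nat \<Rightarrow> (real \<Rightarrow> 'a::real_normed_vector) \<Rightarrow> bool"
  where
    "smooth_upto 0 f \<longleftrightarrow> True"
  | "smooth_upto (Suc n) f \<longleftrightarrow>
      (\<exists>f'. (\<forall>t\<in>{0..1}. (f has_vector_derivative f' t) (at t within {0..1})) \<and> smooth_upto n f')"

lemma smooth_upto_Suc_D: "smooth_upto (Suc n) f \<Longrightarrow> smooth_upto n f"
  by (induction n arbitrary: f) auto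

lemma smooth_upto_const: "smooth_upto n (\<lambda>_. c)"
  by (induction n arbitrary: c) (auto intro!: exI[of _ "\<lambda>_. 0"])

lemma smooth_upto_add: "smooth_upto n f \<Longrightarrow> smooth_upto n g \<Longrightarrow> smooth_upto n (\<lambda>t. f t + g t)"
proof (induction n arbitrary: f g)
  case (Suc n)
  then obtain f' g' where
    "\<forall>t\<in>{0..1}. (f has_vector_derivative f' t) (at t within {0..1})" "smooth_upto n f'"
    "\<forall>t\<in>{0..1}. (g has_vector_derivative g' t) (at t within {0..1})" "smooth_upto n g'"
    by auto
  then show ?case
    using Suc.IH by (auto intro!: exI[of _ "\<lambda>t. f' t + g' t"] has_vector_derivative_add)
qed simp

lemma smooth_upto_sum: "(\<And>i. i \<in> I \<Longrightarrow> smooth_upto n (f i)) \<Longrightarrow> smooth_upto n (\<lambda>t. \<Sum>i\<in>I. f i t)"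
  by (induction I rule: infinite_finite_induct) (auto simp: smooth_upto_const smooth_upto_add)

lemma smooth_upto_linear:
  assumes "bounded_linear h"
  shows "smooth_upto n f \<Longrightarrow> smooth_upto n (\<lambda>t. h (f t))"
proof (induction n arbitrary: f)
  case (Suc n)
  then obtain f' where
    "\<forall>t\<in>{0..1}. (f has_vector_derivative f' t) (at t within {0..1})" "smooth_upto n f'"
    by auto
  then show ?case
    using Suc.IH by (auto intro!: exI[of _ "\<lambda>t. h (f' t)"] bounded_linear.has_vector_derivative[OF assms])
qed simp

lemma smooth_upto_bilinear:
  assumes "bounded_bilinear q"
  shows "smooth_upto n f \<Longrightarrow> smooth_upto n g \<Longrightarrow> smooth_upto n (\<lambda>t. q (f t) (g t))"
proof (induction n arbitrary: f g)
  case (Suc n)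
  then obtain f' g' where
    "\<forall>t\<in>{0..1}. (f has_vector_derivative f' t) (at t within {0..1})" "smooth_upto n f'"
    "\<forall>t\<in>{0..1}. (g has_vector_derivative g' t) (at t within {0..1})" "smooth_upto n g'"
    by auto
  then show ?case
    using Suc.IH Suc.prems[THEN smooth_upto_Suc_D]
    by (auto intro!: exI[of _ "\<lambda>t. q (f t) (g' t) + q (f' t) (g t)"] smooth_upto_add
        bounded_bilinear.has_vector_derivative[OF assms])
qed simp

lemma smooth_upto_cong:
  assumes "\<And>t. t \<in> {0..1} \<Longrightarrow> f t = g t" "smooth_upto n f"
  shows "smooth_upto n g"
proof (cases n)
  case (Suc m)
  then show ?thesis
    using assms has_vector_derivative_cong_unit[of f g] unfolding Suc smooth_upto.simps by blast
qed simp

lemma smooth_upto_velocity: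
  assumes "smooth_upto (Suc n) f"
  shows "smooth_upto n (velocity f)"
proof -
  obtain f' where "\<forall>t\<in>{0..1}. (f has_vector_derivative f' t) (at t within {0..1})" "smooth_upto n f'"
    using assms by auto
  moreover from this have "f' t = velocity f t" if "t \<in> {0..1}" for t
    using velocity_eq[OF that] that by metis
  ultimately show ?thesis
    using smooth_upto_cong by blast
qed

lemma smooth_curve_of_smooth_upto:
  assumes "\<And>n. smooth_upto n f"
  shows "smooth_curve f"
  unfolding smooth_curve_def
proof
  fix n
  have "smooth_upto m ((velocity ^^ n) f)" for m
    by (induction n arbitrary: m) (auto simp: assms intro: smooth_upto_velocity)
  from this[of "Suc 0"] show "(velocity ^^ n) f differentiable_on {0..1}"
    by (auto simp: differentiable_on_def intro: differentiableI_vector)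
qed

lemma bounded_linear_axis: "bounded_linear (axis a :: 'a::real_normed_vector \<Rightarrow> 'a ^ 'n::finite)"
proof (rule bounded_linear_intro[of _ 1])
  fix x :: 'a
  show "norm (axis a x :: 'a ^ 'n) \<le> norm x * 1"
    using norm_vec_le_sum[of "axis a x :: 'a ^ 'n"]
    by (simp add: axis_def if_distrib[of norm] cong: if_cong)
qed (auto simp: vec_eq_iff axis_def)

lemma smooth_upto_triple:
  fixes X U V :: "real \<Rightarrow> 'h::real_inner ^ 'p::finite"
  assumes "smooth_upto n X" "smooth_upto n U" "smooth_upto n V"
  shows "smooth_upto n (\<lambda>t. triple (X t) (U t) (V t))"
proof -
  \<comment> \<open>Assembling the tuple as a sum of \<open>axis\<close> vectors reduces it to sums,
    linear and bilinear maps.\<close>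
  have "triple x u v = (\<Sum>a\<in>UNIV. axis a (\<Sum>b\<in>UNIV. (u $ b \<bullet> v $ a) *\<^sub>R x $ b))" for x u v :: "'h ^ 'p"
    by (simp add: vec_eq_iff axis_def triple_nth)
  moreover have "smooth_upto n (\<lambda>t. \<Sum>a\<in>UNIV. axis a (\<Sum>b\<in>UNIV. (U t $ b \<bullet> V t $ a) *\<^sub>R X t $ b) :: 'h ^ 'p)"
    using assms
    by (intro smooth_upto_sum smooth_upto_linear[OF bounded_linear_axis]
        smooth_upto_bilinear[OF bounded_bilinear_scaleR] smooth_upto_bilinear[OF bounded_bilinear_inner]
        smooth_upto_linear[OF bounded_linear_vec_nth])
  ultimately show ?thesis
    by simp
qed

text \<open>Bootstrapping: if \<open>X\<close> and \<open>V\<close> are differentiable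
  \<open>n\<close> times, so are the right-hand sides of both equations, which gains one derivative
  for each.\<close>

lemma geodesic_equation_smooth:
  assumes X: "\<And>t. t \<in> {0..1} \<Longrightarrow> (X has_vector_derivative V t) (at t within {0..1})"
    and V: "\<And>t. t \<in> {0..1} \<Longrightarrow> (V has_vector_derivative - triple (X t) (V t) (V t)) (at t within {0..1})"
  shows "smooth_upto n X"
proof -
  have "smooth_upto n X \<and> smooth_upto n V"
  proof (induction n)
    case (Suc n)
    then have "smooth_upto n (\<lambda>t. triple (X t) (V t) (V t))"
      by (simp add: smooth_upto_triple)
    then have "smooth_upto n (\<lambda>t. - triple (X t) (V t) (V t))"
      by (rule smooth_upto_linear[OF bounded_linear_minus[OF bounded_linear_ident]])
    then have "smooth_upto (Suc n) V"
      using V unfolding smooth_upto.simps by (intro exI[of _ "\<lambda>t. - triple (X t) (V t) (V t)"]) auto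
    moreover have "smooth_upto (Suc n) X"
      using X Suc unfolding smooth_upto.simps by (intro exI[of _ V]) auto
    ultimately show ?case
      by blast
  qed simp
  then show ?thesis ..
qed


section \<open>The Stiefel manifold\<close>

definition columns :: "((real ^ 'p::finite) \<Rightarrow>\<^sub>L 'h::real_normed_vector) \<Rightarrow> 'h ^ 'p"
  where "columns x = (\<chi> i. blinfun_apply x (axis i 1))"

definition of_columns :: "'h::real_normed_vector ^ 'p::finite \<Rightarrow> (real ^ 'p) \<Rightarrow>\<^sub>L 'h"
  where "of_columns z = Blinfun (\<lambda>u. \<Sum>i\<in>UNIV. u $ i *\<^sub>R z $ i)"

lemma of_columns_apply:
  fixes z :: "'h::real_normed_vector ^ 'p::finite"
  shows "blinfun_apply (of_columns z) u = (\<Sum>i\<in>UNIV. u $ i *\<^sub>R z $ i)"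
proof -
  have "bounded_linear (\<lambda>u :: real ^ 'p. \<Sum>i\<in>UNIV. u $ i *\<^sub>R z $ i)"
    by (intro bounded_linear_sum bounded_linear_scaleR_const bounded_linear_vec_nth)
  then show ?thesis
    by (simp add: of_columns_def bounded_linear_Blinfun_apply)
qed

lemma blinfun_apply_columns: "blinfun_apply x u = (\<Sum>i\<in>UNIV. u $ i *\<^sub>R columns x $ i)"
proof -
  have "blinfun_apply x u = blinfun_apply x (\<Sum>i\<in>UNIV. u $ i *\<^sub>R axis i 1)"
    using basis_expansion[of u] by (simp add: scalar_mult_eq_scaleR)
  then show ?thesis
    by (simp add: columns_def blinfun.sum_right blinfun.scaleR_right)
qed

lemma columns_of_columns [simp]: "columns (of_columns z) = z"
  by (simp add: columns_def of_columns_apply vec_eq_iff axis_def if_distrib[of "\<lambda>r. r *\<^sub>R _"] cong: if_cong)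

lemma of_columns_columns [simp]: "of_columns (columns x) = x"
  by (rule blinfun_eqI) (simp add: of_columns_apply flip: blinfun_apply_columns)

lemma bounded_linear_columns: "bounded_linear (columns :: ((real ^ 'p::finite) \<Rightarrow>\<^sub>L 'h::real_normed_vector) \<Rightarrow> _)"
proof (rule bounded_linear_intro)
  fix x :: "(real ^ 'p) \<Rightarrow>\<^sub>L 'h"
  have "norm (columns x) \<le> (\<Sum>i\<in>UNIV. norm (columns x $ i))"
    by (rule norm_vec_le_sum)
  also have "\<dots> \<le> (\<Sum>i\<in>(UNIV :: 'p set). norm x)"
  proof (rule sum_mono)
    fix i
    show "norm (columns x $ i) \<le> norm x"
      using norm_blinfun[of x "axis i 1"] by (simp add: columns_def norm_axis_1)
  qed
  finally show "norm (columns x) \<le> norm x * CARD('p)"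
    by (simp add: mult.commute)
qed (auto simp: columns_def vec_eq_iff blinfun.add_left blinfun.scaleR_left)

lemma bounded_linear_of_columns: "bounded_linear (of_columns :: 'h::real_normed_vector ^ 'p::finite \<Rightarrow> _)"
proof (rule bounded_linear_intro)
  fix z :: "'h ^ 'p"
  show "norm (of_columns z) \<le> norm z * CARD('p)"
  proof (rule norm_blinfun_bound)
    fix u :: "real ^ 'p"
    have "norm (u $ i *\<^sub>R z $ i) \<le> norm u * norm z" for i
      by (simp add: mult_mono component_le_norm_cart Finite_Cartesian_Product.norm_nth_le)
    then have "norm (blinfun_apply (of_columns z) u) \<le> CARD('p) * (norm u * norm z)"
      unfolding of_columns_apply by (intro sum_norm_bound) auto
    then show "norm (blinfun_apply (of_columns z) u) \<le> norm z * CARD('p) * norm u"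
      by (simp add: mult_ac)
  qed simp
qed (auto intro!: blinfun_eqI simp: of_columns_apply blinfun.add_left blinfun.scaleR_left
    scaleR_add_right sum.distrib scaleR_sum_right mult.commute)

lemma adjoint_columns:
  "adjoint (blinfun_apply x) = (\<lambda>h. \<chi> i. columns x $ i \<bullet> h)"
  by (rule adjoint_unique)
     (simp add: blinfun_apply_columns[of x] inner_sum_left inner_vec_def)

lemma tr_inner_columns: "tr_inner x y = columns x \<bullet> columns y"
  by (simp add: tr_inner_def trace_def matrix_def adjoint_columns inner_vec_def columns_def)

lemma tr_norm_columns: "tr_norm x = norm (columns x)"
  by (simp add: tr_norm_def tr_inner_columns norm_eq_sqrt_inner)

lemma stiefel_columns: "x \<in> stiefel \<longleftrightarrow> columns x \<in> frames"
proof
  assume "x \<in> stiefel"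
  then have "adjoint (blinfun_apply x) (blinfun_apply x (axis b 1)) = axis b 1" for b
    by (simp add: stiefel_def fun_eq_iff)
  then have "(\<chi> i. columns x $ i \<bullet> columns x $ b) = axis b 1" for b
    by (simp add: adjoint_columns columns_def)
  then show "columns x \<in> frames"
    by (auto simp: frames_def vec_eq_iff axis_def)
next
  assume "columns x \<in> frames"
  then have "columns x $ i \<bullet> blinfun_apply x u = u $ i" for i u
    by (simp add: blinfun_apply_columns[of x u] inner_sum_right frames_inner if_distrib cong: if_cong)
  then show "x \<in> stiefel"
    by (simp add: stiefel_def fun_eq_iff adjoint_columns vec_eq_iff)
qed

section \<open>Tangent vectors and normal accelerations\<close>

lemma zero_in_tangent_space:
  assumes "x \<in> M"
  shows "0 \<in> tangent_space M x"
  unfolding tangent_space_def using assms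
  by (intro CollectI exI[of _ "\<lambda>_. x"] exI[of _ 1]) auto

text \<open>Differentiate the Gram matrix, which is constant along a curve of frames.\<close>

lemma tangent_space_stiefel:
  assumes "w \<in> tangent_space stiefel x"
  shows "columns x $ a \<bullet> columns w $ b + columns x $ b \<bullet> columns w $ a = 0"
proof -
  obtain c e where c: "e > 0" "c ` {-e<..<e} \<subseteq> stiefel" "c 0 = x" "(c has_vector_derivative w) (at 0)"
    using assms by (auto simp: tangent_space_def)
  have col: "((\<lambda>t. columns (c t) $ a) has_vector_derivative columns w $ a) (at 0)" for a
    using bounded_linear.has_vector_derivative[OF bounded_linear_vec_nth
        bounded_linear.has_vector_derivative[OF bounded_linear_columns c(4)]] .
  have "((\<lambda>t. columns (c t) $ a \<bullet> columns (c t) $ b) has_vector_derivative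
      columns (c 0) $ a \<bullet> columns w $ b + columns w $ a \<bullet> columns (c 0) $ b) (at 0)"
    by (rule bounded_bilinear.has_vector_derivative[OF bounded_bilinear_inner col col])
  moreover have "columns (c t) $ a \<bullet> columns (c t) $ b = (if a = b then 1 else 0)" if "t \<in> {-e<..<e}" for t
    using c(2) that by (intro frames_inner) (auto simp flip: stiefel_columns)
  then have "((\<lambda>t. columns (c t) $ a \<bullet> columns (c t) $ b) has_vector_derivative 0) (at 0)"
    using c(1)
    by (intro has_vector_derivative_transform_within_open[OF has_vector_derivative_const,
          where S = "{-e<..<e}"]) auto
  ultimately have "columns (c 0) $ a \<bullet> columns w $ b + columns w $ a \<bullet> columns (c 0) $ b = 0"
    by (rule vector_derivative_unique_at)
  then show ?thesis
    by (simp add: c(3) inner_commute)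
qed

text \<open>The tangent space need not be determined completely: \<open>0\<close> lies in it, and its elements \<open>w\<close> satisfy
  \<open>x\<^sup>t w + w\<^sup>t x = 0\<close>, which makes \<open>x v\<^sup>t v\<close> normal.\<close>

lemma tangential_part_triple:
  assumes x: "x \<in> stiefel"
  shows "tangential_part stiefel x (of_columns (- triple (columns x) v v)) = 0"
  unfolding tangential_part_def
proof (rule the_equality)
  let ?a = "of_columns (- triple (columns x) v v)"
  have orth: "tr_inner ?a w = 0" if "w \<in> tangent_space stiefel x" for w
    using tangent_space_stiefel[OF that] by (simp add: tr_inner_columns triple_inner)
  then show "0 \<in> tangent_space stiefel x \<and> (\<forall>w\<in>tangent_space stiefel x. tr_inner (?a - 0) w = 0)"
    using zero_in_tangent_space[OF x] by simp
  fix u assume u: "u \<in> tangent_space stiefel x \<and> (\<forall>w\<in>tangent_space stiefel x. tr_inner (?a - u) w = 0)"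
  \<comment> \<open>Uniqueness: both \<open>?a\<close> and \<open>?a - u\<close> are orthogonal to
    the tangent vector \<open>u\<close>, hence so is \<open>u\<close> itself.\<close>
  then have "tr_inner (?a - u) u = 0" "tr_inner ?a u = 0"
    using orth by blast+
  then have "columns u \<bullet> columns u = 0"
    by (simp add: tr_inner_columns linear_diff[OF bounded_linear.linear[OF bounded_linear_columns]] inner_diff_left)
  then have "of_columns (columns u) = 0"
    by (simp add: linear_0[OF bounded_linear.linear[OF bounded_linear_of_columns]])
  then show "u = 0"
    by simp
qed

text \<open>Turns a competing path of finite length into a competing chain for every
  \<open>N\<close>.\<close>

lemma curve_chords:
  assumes \<gamma>: "valid_path \<gamma>" "path_image \<gamma> \<subseteq> stiefel" and L: "curve_length \<gamma> = ennreal L" "0 \<le> L"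
    and N: "0 < N"
  shows "\<exists>w\<in>chains (columns (pathstart \<gamma>)) (columns (pathfinish \<gamma>)) N.
    \<forall>i<N. norm (w (Suc i) - w i) \<le> L / N"
proof -
  obtain S where cont: "continuous_on {0..1} \<gamma>" and S: "finite S" "\<gamma> C1_differentiable_on ({0..1} - S)"
    using \<gamma>(1) by (auto simp: valid_path_def piecewise_C1_differentiable_on_def)
  obtain D where D: "\<And>t. t \<in> {0..1} - S \<Longrightarrow> (\<gamma> has_vector_derivative D t) (at t)"
    "continuous_on ({0..1} - S) D"
    using S(2) unfolding C1_differentiable_on_def by blast
  define c where "c t = columns (\<gamma> t)" for t
  have vel: "velocity \<gamma> t = D t" if "t \<in> {0..1} - S" for t
    using that has_vector_derivative_at_within[OF D(1)[OF that]] by (intro velocity_eq) auto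
  have "\<exists>\<tau> :: nat \<Rightarrow> real. (\<forall>i\<le>N. \<tau> i \<in> {0..1}) \<and> c (\<tau> 0) = c 0 \<and> c (\<tau> N) = c 1 \<and>
      (\<forall>i<N. norm (c (\<tau> (Suc i)) - c (\<tau> i)) \<le> L / N)"
  proof (rule equal_length_partition[OF _ S(1) _ _ _ L(2) N])
    show "continuous_on {0..1} c"
      unfolding c_def by (rule bounded_linear.continuous_on[OF bounded_linear_columns cont])
    show "(c has_vector_derivative columns (velocity \<gamma> t)) (at t)" if "t \<in> {0..1} - S" for t
      unfolding c_def vel[OF that]
      by (rule bounded_linear.has_vector_derivative[OF bounded_linear_columns D(1)[OF that]])
    show "continuous_on ({0..1} - S) (\<lambda>t. columns (velocity \<gamma> t))"
      using bounded_linear.continuous_on[OF bounded_linear_columns D(2)]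
      by (rule continuous_on_eq) (simp add: vel)
    show "(\<integral>\<^sup>+t\<in>{0..1}. ennreal (norm (columns (velocity \<gamma> t))) \<partial>lborel) = ennreal L"
      using L(1) by (simp add: curve_length_def tr_norm_columns)
  qed
  then obtain \<tau> :: "nat \<Rightarrow> real" where \<tau>: "\<And>i. i \<le> N \<Longrightarrow> \<tau> i \<in> {0..1}" "c (\<tau> 0) = c 0" "c (\<tau> N) = c 1"
    "\<And>i. i < N \<Longrightarrow> norm (c (\<tau> (Suc i)) - c (\<tau> i)) \<le> L / N"
    by blast
  have fr: "c t \<in> frames" if "t \<in> {0..1}" for t
    using \<gamma>(2) that unfolding c_def stiefel_columns[symmetric] path_image_def by blast
  have "columns (pathstart \<gamma>) = c 0" "columns (pathfinish \<gamma>) = c 1"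
    by (simp_all add: c_def pathstart_def pathfinish_def)
  then have "(\<lambda>i. c (\<tau> i)) \<in> chains (columns (pathstart \<gamma>)) (columns (pathfinish \<gamma>)) N"
    unfolding chains_def using \<tau>(2,3) fr[OF \<tau>(1)] by simp
  then show ?thesis
    by (rule bexI[rotated]) (simp add: \<tau>(4))
qed

lemma minimizing_geodesic_exists:
  fixes x y :: "(real ^ 'p::finite) \<Rightarrow>\<^sub>L 'h::{real_inner, complete_space}"
  assumes "joined (columns x) (columns y)"
  shows "\<exists>\<gamma>. minimizing_geodesic stiefel \<gamma> \<and> pathstart \<gamma> = x \<and> pathfinish \<gamma> = y"
proof -
  obtain X V v where ends: "X 0 = columns x" "X 1 = columns y"
    and X: "\<And>t. t \<in> {0..1} \<Longrightarrow> X t \<in> frames"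
    and speed: "\<And>t. t \<in> {0..1} \<Longrightarrow> norm (V t) = v"
    and dX: "\<And>t. t \<in> {0..1} \<Longrightarrow> (X has_vector_derivative V t) (at t within {0..1})"
    and dV: "\<And>t. t \<in> {0..1} \<Longrightarrow> (V has_vector_derivative - triple (X t) (V t) (V t)) (at t within {0..1})"
    and shortest: "\<And>L. 0 \<le> L \<Longrightarrow> (\<And>N. 0 < N \<Longrightarrow>
        \<exists>w\<in>chains (columns x) (columns y) N. \<forall>i<N. norm (w (Suc i) - w i) \<le> L / N) \<Longrightarrow> v \<le> L"
    using limit_of_minimal_chains[OF assms] by blast
  define \<gamma> where "\<gamma> t = of_columns (X t)" for t
  have d\<gamma>: "(\<gamma> has_vector_derivative of_columns (V t)) (at t within {0..1})" if "t \<in> {0..1}" for t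
    unfolding \<gamma>_def by (rule bounded_linear.has_vector_derivative[OF bounded_linear_of_columns dX[OF that]])
  have vel: "velocity \<gamma> t = of_columns (V t)" if "t \<in> {0..1}" for t
    by (rule velocity_eq[OF that d\<gamma>[OF that]])
  have acc: "velocity (velocity \<gamma>) t = of_columns (- triple (X t) (V t) (V t))" if "t \<in> {0..1}" for t
  proof -
    have "((\<lambda>s. of_columns (V s)) has_vector_derivative of_columns (- triple (X t) (V t) (V t))) (at t within {0..1})"
      by (rule bounded_linear.has_vector_derivative[OF bounded_linear_of_columns dV[OF that]])
    then have "(velocity \<gamma> has_vector_derivative of_columns (- triple (X t) (V t) (V t))) (at t within {0..1})"
      by (rule has_vector_derivative_cong_unit[rotated 2]) (rule vel[symmetric], assumption, rule that)
    then show ?thesis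
      by (rule velocity_eq[OF that])
  qed
  have ends\<gamma>: "pathstart \<gamma> = x" "pathfinish \<gamma> = y"
    by (simp_all add: pathstart_def pathfinish_def \<gamma>_def ends)
  have image: "path_image \<gamma> \<subseteq> stiefel"
    using X by (auto simp: path_image_def \<gamma>_def stiefel_columns)
  have "smooth_curve \<gamma>"
    unfolding \<gamma>_def
    by (intro smooth_curve_of_smooth_upto smooth_upto_linear[OF bounded_linear_of_columns]
        geodesic_equation_smooth[OF dX dV])
  moreover have "covariant_derivative stiefel \<gamma> (velocity \<gamma>) t = 0" if "t \<in> {0..1}" for t
  proof -
    have "\<gamma> t \<in> stiefel"
      using X[OF that] by (simp add: \<gamma>_def stiefel_columns)
    from tangential_part_triple[OF this, of "V t"] show ?thesis
      by (simp add: covariant_derivative_def acc[OF that]) (simp add: \<gamma>_def)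
  qed
  ultimately have "geodesic stiefel \<gamma>"
    using image by (simp add: geodesic_def)
  moreover have len: "curve_length \<gamma> = ennreal v"
  proof -
    have "curve_length \<gamma> = (\<integral>\<^sup>+t. ennreal v * indicator {0..1::real} t \<partial>lborel)"
      unfolding curve_length_def
      by (intro nn_integral_cong) (auto simp: tr_norm_columns vel speed indicator_def)
    then show ?thesis
      by (simp add: nn_integral_cmult_indicator)
  qed
  moreover have "valid_path \<gamma>"
    unfolding valid_path_def piecewise_C1_differentiable_on_def C1_differentiable_on_def
  \<comment> \<open>Only one-sided derivatives are at hand at the end points, so these are taken as
    break points.\<close>
  proof (intro conjI exI[of _ "{0, 1}"] exI[of _ "\<lambda>t. of_columns (V t)"] ballI)
    show "continuous_on {0..1} \<gamma>"
      by (rule continuous_on_vector_derivative[OF d\<gamma>])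
    have "continuous_on {0..1} (\<lambda>t. of_columns (V t))"
      by (rule bounded_linear.continuous_on[OF bounded_linear_of_columns continuous_on_vector_derivative[OF dV]])
    then show "continuous_on ({0..1} - {0, 1}) (\<lambda>t. of_columns (V t))"
      by (rule continuous_on_subset) auto
    fix t :: real assume "t \<in> {0..1} - {0, 1}"
    then have "t \<in> {0..1}" "0 < t" "t < 1"
      by auto
    then show "(\<gamma> has_vector_derivative of_columns (V t)) (at t)"
      using d\<gamma>[of t] by (simp add: at_within_Icc_at)
  qed simp
  then have "riemannian_dist stiefel x y \<le> curve_length \<gamma>"
    unfolding riemannian_dist_def using image ends\<gamma> by (intro Inf_lower imageI) auto
  moreover have "curve_length \<gamma> \<le> riemannian_dist stiefel x y"
    unfolding riemannian_dist_def
  proof (rule Inf_greatest)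
    fix l assume "l \<in> curve_length ` {\<gamma>. valid_path \<gamma> \<and> path_image \<gamma> \<subseteq> stiefel \<and>
      pathstart \<gamma> = x \<and> pathfinish \<gamma> = y}"
    then obtain \<delta> where \<delta>: "valid_path \<delta>" "path_image \<delta> \<subseteq> stiefel" "pathstart \<delta> = x" "pathfinish \<delta> = y"
      "l = curve_length \<delta>"
      by auto
    show "curve_length \<gamma> \<le> l"
    \<comment> \<open>A competitor of infinite length is trivially no shorter; a finite length
      \<open>r\<close> bounds the constant speed \<open>v\<close>, which is the length of
      \<open>\<gamma>\<close>.\<close>
    proof (cases l)
      case (real r)
      then have "v \<le> r"
        using curve_chords[OF \<delta>(1,2)] \<delta>(3-5) by (intro shortest) auto
      then show ?thesis
        using real by (simp add: len ennreal_leI)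
    qed simp
  qed
  ultimately have "minimizing_geodesic stiefel \<gamma>"
    unfolding minimizing_geodesic_def ends\<gamma> by simp
  then show ?thesis
    using ends\<gamma> by blast
qed

theorem proposition2p3:
  assumes "(\<exists>B :: 'h::{real_inner, complete_space} set. finite B \<and> span B = UNIV) \<longrightarrow>
    dim (UNIV :: 'h set) \<ge> 2 * CARD('p::finite)"
  shows "hopf_rinow (stiefel :: ((real ^ 'p) \<Rightarrow>\<^sub>L 'h) set)"
  unfolding hopf_rinow_def
proof (intro ballI)
  fix x y :: "(real ^ 'p) \<Rightarrow>\<^sub>L 'h"
  assume "x \<in> stiefel" "y \<in> stiefel"
  then have "joined (columns x) (columns y)"
    using unit_normal_of_large_dim[OF assms]
    by (intro frames_joined) (auto simp: stiefel_columns)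
  then show "\<exists>\<gamma>. minimizing_geodesic stiefel \<gamma> \<and> pathstart \<gamma> = x \<and> pathfinish \<gamma> = y"
    by (rule minimizing_geodesic_exists)
qed

end
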